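(* $\#\mathsf{\Pi_2\text{-}1VAR}\subseteq\mathsf{TotP}$.
   Context: A counting problem $\#B$ on finite ordered $\sigma$-structures ($\sigma$ a relational vocabulary) belongs to $\#\mathsf{\Pi_2\text{-}1VAR}$ if there is a formula $\psi(\vec y,\vec z,X)=\phi(\vec y,\vec z)\wedge X(\vec z)$, with $\phi$ a first-order formula over $\sigma$ and $X$ a single second-order variable (occurring positively), such that for every input structure $\mathcal{A}$, $\#B(\mathcal{A})=|\{\langle X\rangle : \mathcal{A}\models\forall\vec y\exists\vec z\,\psi(\vec y,\vec z,X)\}|$. $\mathsf{TotP}=\{tot_M \mid M \text{ a nondeterministic polynomial-time Turing machine}\}$, where $tot_M(x)$ is the number of all computation paths of $M$ on input $x$ minus $1$; functions on structures are viewed as functions on their string encodings. *)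

theory Defs
  imports "HOL-Computational_Algebra.Polynomial"
begin

section \<open>Finite ordered structures\<close>

text \<open>A finite relational vocabulary is the list of arities of its relation symbols; the
  symbols themselves are the indices of that list.\<close>

type_synonym vocabulary = "nat list"

text \<open>As usual for finite ordered structures, the universe is the nonempty set
  \<open>{..<univ_size A}\<close>, and the linear order of the structure is the order of \<^typ>\<open>nat\<close>.
  The order is available to formulas through the atoms \<open>Le\<close> below, so it is not listed among the
  relations \<open>rels A\<close>.\<close>

record fin_struct =
  univ_size :: nat
  rels :: "nat list set list"

definition tuples :: "nat \<Rightarrow> nat \<Rightarrow> nat list set" where
  "tuples n r = {v. length v = r \<and> set v \<subseteq> {..<n}}"

definition structures :: "vocabulary \<Rightarrow> fin_struct set" where
  "structures \<sigma> = {A. univ_size A \<ge> 1 \<and> length (rels A) = length \<sigma> \<and>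
     (\<forall>i < length \<sigma>. rels A ! i \<subseteq> tuples (univ_size A) (\<sigma> ! i))}"

text \<open>The standard string encoding \<open>0\<^sup>n 1 w\<^sub>1 \<dots> w\<^sub>k\<close>: \<open>w\<^sub>i\<close> is the
  characteristic string of the \<open>i\<close>-th relation along the lexicographic list of all tuples
  (which is the order in which \<^const>\<open>product_lists\<close> lists them).\<close>

definition encode :: "vocabulary \<Rightarrow> fin_struct \<Rightarrow> bool list" where
  "encode \<sigma> A = replicate (univ_size A) False @ [True] @
     concat (map2 (\<lambda>r R. map (\<lambda>v. v \<in> R) (product_lists (replicate r [0..<univ_size A])))
       \<sigma> (rels A))"

text \<open>A function on \<open>\<sigma>\<close>-structures viewed as a function on strings. Strings that do not
  encode a structure get the value 0. The lemma \<open>inj_on_encode\<close> below shows that no choice is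
  involved.\<close>

definition on_strings :: "vocabulary \<Rightarrow> (fin_struct \<Rightarrow> nat) \<Rightarrow> bool list \<Rightarrow> nat" where
  "on_strings \<sigma> B s =
     (if s \<in> encode \<sigma> ` structures \<sigma> then B (inv_into (structures \<sigma>) (encode \<sigma>) s) else 0)"


section \<open>Formulas\<close>

text \<open>Formulas over a vocabulary with equality and order, and with atoms \<open>SOVar xs\<close> for a single
  second-order variable \<open>X\<close> applied to the first-order variables \<open>xs\<close>.\<close>

datatype formula =
    Rel nat "nat list"
  | Eq nat nat
  | Le nat nat
  | SOVar "nat list"
  | Neg formula
  | Conj formula formula
  | Exists nat formula

definition Forall :: "nat \<Rightarrow> formula \<Rightarrow> formula" where
  "Forall x \<phi> = Neg (Exists x (Neg \<phi>))"

primrec sat :: "fin_struct \<Rightarrow> nat list set \<Rightarrow> (nat \<Rightarrow> nat) \<Rightarrow> formula \<Rightarrow> bool" where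
  "sat A X e (Rel i xs) \<longleftrightarrow> map e xs \<in> rels A ! i"
| "sat A X e (Eq x y) \<longleftrightarrow> e x = e y"
| "sat A X e (Le x y) \<longleftrightarrow> e x \<le> e y"
| "sat A X e (SOVar xs) \<longleftrightarrow> map e xs \<in> X"
| "sat A X e (Neg \<phi>) \<longleftrightarrow> \<not> sat A X e \<phi>"
| "sat A X e (Conj \<phi> \<psi>) \<longleftrightarrow> sat A X e \<phi> \<and> sat A X e \<psi>"
| "sat A X e (Exists x \<phi>) \<longleftrightarrow> (\<exists>a < univ_size A. sat A X (e(x := a)) \<phi>)"

primrec free_vars :: "formula \<Rightarrow> nat set" where
  "free_vars (Rel i xs) = set xs"
| "free_vars (Eq x y) = {x, y}"
| "free_vars (Le x y) = {x, y}"
| "free_vars (SOVar xs) = set xs"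
| "free_vars (Neg \<phi>) = free_vars \<phi>"
| "free_vars (Conj \<phi> \<psi>) = free_vars \<phi> \<union> free_vars \<psi>"
| "free_vars (Exists x \<phi>) = free_vars \<phi> - {x}"

text \<open>First-order formulas over the vocabulary, i.e. without occurrences of \<open>X\<close>.\<close>

primrec first_order :: "vocabulary \<Rightarrow> formula \<Rightarrow> bool" where
  "first_order \<sigma> (Rel i xs) \<longleftrightarrow> i < length \<sigma> \<and> length xs = \<sigma> ! i"
| "first_order \<sigma> (Eq x y) \<longleftrightarrow> True"
| "first_order \<sigma> (Le x y) \<longleftrightarrow> True"
| "first_order \<sigma> (SOVar xs) \<longleftrightarrow> False"
| "first_order \<sigma> (Neg \<phi>) \<longleftrightarrow> first_order \<sigma> \<phi>"
| "first_order \<sigma> (Conj \<phi> \<psi>) \<longleftrightarrow> first_order \<sigma> \<phi> \<and> first_order \<sigma> \<psi>"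
| "first_order \<sigma> (Exists x \<phi>) \<longleftrightarrow> first_order \<sigma> \<phi>"

text \<open>The sentence \<open>\<forall>ys. \<exists>zs. \<phi>(ys, zs) \<and> X(zs)\<close>.\<close>

definition Pi2_1VAR_sentence :: "nat list \<Rightarrow> nat list \<Rightarrow> formula \<Rightarrow> formula" where
  "Pi2_1VAR_sentence ys zs \<phi> = foldr Forall ys (foldr Exists zs (Conj \<phi> (SOVar zs)))"

text \<open>The number of relations \<open>X\<close> of arity \<open>m\<close> that satisfy a sentence. The assignment
  is irrelevant for sentences; 0 is an element of every universe.\<close>

definition count_SO :: "nat \<Rightarrow> formula \<Rightarrow> fin_struct \<Rightarrow> nat" where
  "count_SO m \<psi> A = card {X. X \<subseteq> tuples (univ_size A) m \<and> sat A X (\<lambda>_. 0) \<psi>}"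

definition sharp_Pi2_1VAR :: "vocabulary \<Rightarrow> (fin_struct \<Rightarrow> nat) set" where
  "sharp_Pi2_1VAR \<sigma> = {B. \<exists>ys zs \<phi>. distinct (ys @ zs) \<and> first_order \<sigma> \<phi> \<and>
     free_vars \<phi> \<subseteq> set (ys @ zs) \<and>
     (\<forall>A \<in> structures \<sigma>. B A = count_SO (length zs) (Pi2_1VAR_sentence ys zs \<phi>) A)}"


section \<open>Nondeterministic Turing machines\<close>

text \<open>Machines with a fixed number of two-way infinite tapes. A transition
  \<open>(q, as, q', bs, ds)\<close> is enabled in state \<open>q\<close> when the heads read \<open>as\<close>; it writes
  \<open>bs\<close>, moves the heads by \<open>ds\<close> and enters \<open>q'\<close>. A machine halts when no transition is
  enabled. Accepting states are left out because the number of all computation paths does not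
  depend on them.\<close>

datatype move = Lft | Stay | Rgt

type_synonym transition = "nat \<times> nat list \<times> nat \<times> nat list \<times> move list"

record ntm =
  num_tapes :: nat
  states :: "nat set"
  start :: nat
  symbols :: "nat set"
  delta :: "transition set"

definition blank :: nat where
  "blank = 0"

definition symbol_of_bit :: "bool \<Rightarrow> nat" where
  "symbol_of_bit b = (if b then 2 else 1)"

definition wf_ntm :: "ntm \<Rightarrow> bool" where
  "wf_ntm M \<longleftrightarrow> num_tapes M \<ge> 1 \<and> finite (states M) \<and> start M \<in> states M \<and>
     finite (symbols M) \<and> blank \<in> symbols M \<and> range symbol_of_bit \<subseteq> symbols M \<and>
     (\<forall>(q, as, q', bs, ds) \<in> delta M. q \<in> states M \<and> q' \<in> states M \<and>
        length as = num_tapes M \<and> set as \<subseteq> symbols M \<and>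
        length bs = num_tapes M \<and> set bs \<subseteq> symbols M \<and>
        length ds = num_tapes M)"

text \<open>A tape is a head position with the contents of the cells; a configuration is a state with
  the list of tapes.\<close>

type_synonym tape = "int \<times> (int \<Rightarrow> nat)"
type_synonym config = "nat \<times> tape list"

primrec offset :: "move \<Rightarrow> int" where
  "offset Lft = -1"
| "offset Stay = 0"
| "offset Rgt = 1"

definition read_tape :: "tape \<Rightarrow> nat" where
  "read_tape = (\<lambda>(h, f). f h)"

definition update_tape :: "tape \<Rightarrow> nat \<Rightarrow> move \<Rightarrow> tape" where
  "update_tape = (\<lambda>(h, f) b d. (h + offset d, f(h := b)))"

definition enabled :: "ntm \<Rightarrow> config \<Rightarrow> transition set" where
  "enabled M = (\<lambda>(p, ts). {(q, as, q', bs, ds) \<in> delta M. q = p \<and> as = map read_tape ts})"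

definition fire :: "transition \<Rightarrow> config \<Rightarrow> config" where
  "fire = (\<lambda>(q, as, q', bs, ds) (p, ts).
     (q', map2 (\<lambda>t (b, d). update_tape t b d) ts (zip bs ds)))"

definition input_tape :: "bool list \<Rightarrow> tape" where
  "input_tape x = (0, \<lambda>i. if 0 \<le> i \<and> i < int (length x) then symbol_of_bit (x ! nat i) else blank)"

definition init_config :: "ntm \<Rightarrow> bool list \<Rightarrow> config" where
  "init_config M x =
     (start M, input_tape x # replicate (num_tapes M - 1) (0, \<lambda>_. blank))"

text \<open>\<open>run M c ts c'\<close>: firing the transitions \<open>ts\<close> successively leads from \<open>c\<close> to
  \<open>c'\<close>. Distinct transitions enabled in a configuration of a machine lead to distinct
  configurations, so sequences of transitions and sequences of configurations correspond to each
  other.\<close>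

inductive run :: "ntm \<Rightarrow> config \<Rightarrow> transition list \<Rightarrow> config \<Rightarrow> bool" for M where
  run_Nil: "run M c [] c"
| run_Cons: "t \<in> enabled M c \<Longrightarrow> run M (fire t c) ts c' \<Longrightarrow> run M c (t # ts) c'"

definition computation_paths :: "ntm \<Rightarrow> bool list \<Rightarrow> transition list set" where
  "computation_paths M x = {ts. \<exists>c. run M (init_config M x) ts c \<and> enabled M c = {}}"

text \<open>The bound is on all runs, halting or not; in particular every run can be extended to a
  computation path.\<close>

definition poly_time :: "ntm \<Rightarrow> bool" where
  "poly_time M \<longleftrightarrow>
     (\<exists>p :: nat poly. \<forall>x ts c. run M (init_config M x) ts c \<longrightarrow> length ts \<le> poly p (length x))"

definition tot :: "ntm \<Rightarrow> bool list \<Rightarrow> nat" where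
  "tot M x = card (computation_paths M x) - 1"

definition TotP :: "(bool list \<Rightarrow> nat) set" where
  "TotP = {tot M | M. wf_ntm M \<and> poly_time M}"


section \<open>Well-definedness\<close>

lemma set_product_lists_upt: "set (product_lists (replicate r [0..<n])) = tuples n r"
proof (induction r)
  case 0
  then show ?case by (auto simp: tuples_def)
next
  case (Suc r)
  show ?case
  proof (intro set_eqI iffI)
    fix v
    assume "v \<in> set (product_lists (replicate (Suc r) [0..<n]))"
    then show "v \<in> tuples n (Suc r)" using Suc by (auto simp: tuples_def)
  next
    fix v
    assume "v \<in> tuples n (Suc r)"
    then obtain a w where "v = a # w" "a < n" "w \<in> tuples n r"
      by (cases v) (auto simp: tuples_def)
    then show "v \<in> set (product_lists (replicate (Suc r) [0..<n]))" using Suc by auto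
  qed
qed

lemma inj_on_encode: "inj_on (encode \<sigma>) (structures \<sigma>)"
proof (rule inj_onI)
  fix A B
  assume A: "A \<in> structures \<sigma>" and B: "B \<in> structures \<sigma>" and eq: "encode \<sigma> A = encode \<sigma> B"
  have "takeWhile Not (encode \<sigma> C) = replicate (univ_size C) False" for C
    by (simp add: encode_def takeWhile_append)
  then have n: "univ_size A = univ_size B"
    by (metis eq length_replicate)
  let ?w = "\<lambda>r R. map (\<lambda>v. v \<in> R) (product_lists (replicate r [0..<univ_size A]))"
  have "\<lbrakk>length Rs = length \<sigma>; length Ss = length \<sigma>;
      \<forall>i < length \<sigma>. Rs ! i \<subseteq> tuples (univ_size A) (\<sigma> ! i);
      \<forall>i < length \<sigma>. Ss ! i \<subseteq> tuples (univ_size A) (\<sigma> ! i);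
      concat (map2 ?w \<sigma> Rs) = concat (map2 ?w \<sigma> Ss)\<rbrakk> \<Longrightarrow> Rs = Ss" for Rs Ss
  proof (induction \<sigma> arbitrary: Rs Ss)
    case Nil
    then show ?case by simp
  next
    case (Cons r \<sigma>)
    obtain R Rs' where Rs: "Rs = R # Rs'" using Cons.prems(1) by (cases Rs) auto
    obtain S Ss' where Ss: "Ss = S # Ss'" using Cons.prems(2) by (cases Ss) auto
    have *: "?w r R = ?w r S" "concat (map2 ?w \<sigma> Rs') = concat (map2 ?w \<sigma> Ss')"
      using Cons.prems(5) by (simp_all add: Rs Ss)
    have "R \<subseteq> tuples (univ_size A) r" "S \<subseteq> tuples (univ_size A) r"
      using Cons.prems(3,4)[THEN spec, of 0] by (simp_all add: Rs Ss)
    moreover have "\<forall>v \<in> tuples (univ_size A) r. v \<in> R \<longleftrightarrow> v \<in> S"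
      using *(1) by (simp add: set_product_lists_upt)
    ultimately have "R = S" by blast
    moreover have "Rs' = Ss'"
    proof (rule Cons.IH)
      show "\<forall>i < length \<sigma>. Rs' ! i \<subseteq> tuples (univ_size A) (\<sigma> ! i)"
        using Cons.prems(3) unfolding Rs by (metis Suc_less_eq length_Cons nth_Cons_Suc)
      show "\<forall>i < length \<sigma>. Ss' ! i \<subseteq> tuples (univ_size A) (\<sigma> ! i)"
        using Cons.prems(4) unfolding Ss by (metis Suc_less_eq length_Cons nth_Cons_Suc)
    qed (use Cons.prems *(2) in \<open>auto simp: Rs Ss\<close>)
    ultimately show ?case by (simp add: Rs Ss)
  qed
  then have "rels A = rels B"
    using A B eq n by (auto simp: structures_def encode_def)
  with n show "A = B" by simp
qed

lemma on_strings_encode: "A \<in> structures \<sigma> \<Longrightarrow> on_strings \<sigma> B (encode \<sigma> A) = B A"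
  by (simp add: on_strings_def inv_into_f_f inj_on_encode)

lemma finite_delta:
  assumes "wf_ntm M"
  shows "finite (delta M)"
proof -
  let ?L = "{as. set as \<subseteq> symbols M \<and> length as = num_tapes M}"
  have "finite (UNIV :: move set)"
  proof -
    have "UNIV = {Lft, Stay, Rgt}" using move.exhaust by blast
    then show ?thesis by (metis finite.emptyI finite.insertI)
  qed
  then have "finite {ds :: move list. set ds \<subseteq> UNIV \<and> length ds = num_tapes M}"
    by (rule finite_lists_length_eq)
  moreover have "finite ?L"
    using assms by (intro finite_lists_length_eq) (simp add: wf_ntm_def)
  ultimately have "finite (states M \<times> ?L \<times> states M \<times> ?L \<times>
      {ds :: move list. set ds \<subseteq> UNIV \<and> length ds = num_tapes M})"
    using assms by (intro finite_cartesian_product) (auto simp: wf_ntm_def)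
  then show ?thesis
    by (rule rev_finite_subset) (use assms in \<open>auto simp: wf_ntm_def\<close>)
qed

lemma run_snoc: "run M c ts c' \<Longrightarrow> t \<in> enabled M c' \<Longrightarrow> run M c (ts @ [t]) (fire t c')"
  by (induction rule: run.induct) (auto intro: run.intros)

lemma run_in_delta: "run M c ts c' \<Longrightarrow> set ts \<subseteq> delta M"
  by (induction rule: run.induct) (auto simp: enabled_def split: prod.splits)

text \<open>For the machines in the definition of \<^const>\<open>TotP\<close>, the cardinality and the subtraction
  in \<^const>\<open>tot\<close> have their intended meaning.\<close>

lemma computation_paths_finite_nonempty:
  assumes "wf_ntm M" "poly_time M"
  shows "finite (computation_paths M x)" "computation_paths M x \<noteq> {}"
proof -
  obtain p :: "nat poly"
    where "\<forall>x ts c. run M (init_config M x) ts c \<longrightarrow> length ts \<le> poly p (length x)"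
    using assms(2) unfolding poly_time_def ..
  then have p: "length ts \<le> poly p (length x)" if "run M (init_config M x) ts c" for ts c
    using that by blast
  have "computation_paths M x \<subseteq> {ts. set ts \<subseteq> delta M \<and> length ts \<le> poly p (length x)}"
    unfolding computation_paths_def using p run_in_delta by blast
  then show "finite (computation_paths M x)"
    using finite_lists_length_le[OF finite_delta[OF assms(1)]] finite_subset by blast
  show "computation_paths M x \<noteq> {}"
  proof
    assume empty: "computation_paths M x = {}"
    have "\<exists>ts c. run M (init_config M x) ts c \<and> length ts = k" for k
    proof (induction k)
      case 0
      then show ?case using run_Nil by blast
    next
      case (Suc k)
      then obtain ts c where r: "run M (init_config M x) ts c" "length ts = k" by blast
      then obtain t where "t \<in> enabled M c" using empty unfolding computation_paths_def by blast
      then have "run M (init_config M x) (ts @ [t]) (fire t c)" using r by (simp add: run_snoc)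
      then show ?case using r(2) by (metis length_append_singleton)
    qed
    then obtain ts c where "run M (init_config M x) ts c" "length ts = Suc (poly p (length x))"
      by blast
    then show False using p[of ts c] by simp
  qed
qed

end

theory Submission
  imports Defs "HOL-Library.Countable"
begin

text \<open>The sentence is monotone in \<open>X\<close>. Hence, when the tuples are decided one after the other and the
  undecided ones are taken to be in \<open>X\<close>, the current \<open>X\<close> can be completed to a model if and only if
  it is a model, which is tested in polynomial time. A machine that tests first whether the full
  relation is a model, and then tentatively removes each tuple and branches if the result is
  still a model, has one halting path for every model, since no branch is a dead end. One more
  path, split off at the start if there is a model at all, accounts for the subtraction of 1 in
  \<^const>\<open>tot\<close>.

  Machines are obtained from a language of bounded loops whose variables range over the universe.
  Random access to the table of a relation is a scan of the table in lexicographic order, in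
  parallel with nested loops over all tuples.\<close>

section \<open>Structured programs for Turing machines\<close>

text \<open>Since \<open>tot\<close> counts every path, accepting or not, the number of paths has to
  be exact on every string. A structure without models and a string that encodes no structure must
  leave exactly one path, so that the subtraction yields 0; hence the test of the input belongs to
  the machine. The semantics at each level lists final stores, one entry per execution, so that
  executions ending in the same store are counted separately. A time bound is carried along with the
  list, because it has to hold for all runs. Loops over the universe suffice since the formula is
  fixed: it has finitely many variables with values below \<open>n\<close>. An index into a table of
  \<open>n ^ r\<close> tuples fits into no single variable, but a head position can represent
  it.\<close>

datatype cmd =
    CMove nat move
  | CWrite nat "nat list"
  | CSeq cmd cmd
  | CIf "(nat \<times> nat) list" cmd cmd
  | CWhile "(nat \<times> nat) list" cmd

instance move :: countable
  by countable_datatype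

instance cmd :: countable
  by countable_datatype

type_synonym store = "nat \<Rightarrow> tape"

definition holds :: "(nat \<times> nat) list \<Rightarrow> (nat \<Rightarrow> nat) \<Rightarrow> bool" where
  "holds ts r \<longleftrightarrow> (\<forall>(i, a) \<in> set ts. r i = a)"

definition reads :: "store \<Rightarrow> nat \<Rightarrow> nat" where
  "reads s i = read_tape (s i)"

text \<open>The control state is the stack of commands that remain to be executed.\<close>

primrec next_cmds :: "cmd \<Rightarrow> (nat \<Rightarrow> nat) \<Rightarrow> cmd list" where
  "next_cmds (CMove i m) r = []"
| "next_cmds (CWrite i ws) r = []"
| "next_cmds (CSeq a b) r = [a, b]"
| "next_cmds (CIf ts a b) r = [if holds ts r then a else b]"
| "next_cmds (CWhile ts a) r = (if holds ts r then [a, CWhile ts a] else [])"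

primrec actions :: "cmd \<Rightarrow> (nat \<Rightarrow> nat) \<Rightarrow> (nat \<times> nat \<times> move) list" where
  "actions (CMove i m) r = [(i, r i, m)]"
| "actions (CWrite i ws) r = map (\<lambda>w. (i, w, Stay)) ws"
| "actions (CSeq a b) r = [(0, r 0, Stay)]"
| "actions (CIf ts a b) r = [(0, r 0, Stay)]"
| "actions (CWhile ts a) r = [(0, r 0, Stay)]"

definition act :: "nat \<times> nat \<times> move \<Rightarrow> store \<Rightarrow> store" where
  "act = (\<lambda>(i, w, m) s. s(i := update_tape (s i) w m))"

text \<open>\<open>tree K s T N\<close>: from the stack \<open>K\<close> and the store \<open>s\<close>, all runs have length at most
  \<open>T\<close>, and \<open>N\<close> of them are halting.\<close>

inductive tree :: "cmd list \<Rightarrow> store \<Rightarrow> nat \<Rightarrow> nat \<Rightarrow> bool" where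
  tree_Nil: "tree [] s T 1"
| tree_Cons: "(\<And>a. a \<in> set (actions c (reads s)) \<Longrightarrow>
      tree (next_cmds c (reads s) @ K) (act a s) T (N a)) \<Longrightarrow>
    tree (c # K) s (Suc T) (\<Sum>a\<leftarrow>actions c (reads s). N a)"

text \<open>Distinct written symbols make different actions different transitions, and nonempty
  lists of them prevent a halt with commands left on the stack. The symbols up to 2 are the blank
  and the two bits.\<close>

primrec cmd_wf :: "nat \<Rightarrow> cmd \<Rightarrow> bool" where
  "cmd_wf k (CMove i m) \<longleftrightarrow> i < k"
| "cmd_wf k (CWrite i ws) \<longleftrightarrow> i < k \<and> distinct ws \<and> ws \<noteq> [] \<and> set ws \<subseteq> {..2}"
| "cmd_wf k (CSeq a b) \<longleftrightarrow> cmd_wf k a \<and> cmd_wf k b"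
| "cmd_wf k (CIf ts a b) \<longleftrightarrow> fst ` set ts \<subseteq> {..<k} \<and> cmd_wf k a \<and> cmd_wf k b"
| "cmd_wf k (CWhile ts a) \<longleftrightarrow> fst ` set ts \<subseteq> {..<k} \<and> cmd_wf k a"

text \<open>The stacks that occur while \<open>c\<close> is executed on top of \<open>K\<close>, except for \<open>K\<close> itself.\<close>

primrec stacks :: "cmd \<Rightarrow> cmd list \<Rightarrow> cmd list set" where
  "stacks (CMove i m) K = {CMove i m # K}"
| "stacks (CWrite i ws) K = {CWrite i ws # K}"
| "stacks (CSeq a b) K = {CSeq a b # K} \<union> stacks a (b # K) \<union> stacks b K"
| "stacks (CIf ts a b) K = {CIf ts a b # K} \<union> stacks a K \<union> stacks b K"
| "stacks (CWhile ts a) K = {CWhile ts a # K} \<union> stacks a (CWhile ts a # K)"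

text \<open>The list \<open>as\<close> of the symbols read takes the place of
  \<open>reads s\<close>. Its entries below \<open>k\<close> are enough, as \<open>cmd_wf k\<close>
  confines tests and actions to these tapes.\<close>

definition transition_of :: "nat \<Rightarrow> cmd \<Rightarrow> cmd list \<Rightarrow> nat list \<Rightarrow> nat \<times> nat \<times> move \<Rightarrow> transition" where
  "transition_of k c K as = (\<lambda>(i, w, m).
     (to_nat (c # K), as, to_nat (next_cmds c ((!) as) @ K), as[i := w], (replicate k Stay)[i := m]))"

definition machine :: "nat \<Rightarrow> cmd \<Rightarrow> ntm" where
  "machine k P = \<lparr>num_tapes = k, states = to_nat ` insert [] (stacks P []), start = to_nat [P],
     symbols = {..2},
     delta = {transition_of k c K as a | c K as a. c # K \<in> stacks P [] \<and> length as = k \<and>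
       set as \<subseteq> {..2} \<and> a \<in> set (actions c ((!) as))}\<rparr>"

section \<open>Finite control and locality of commands\<close>

lemma finite_stacks: "finite (stacks c K)"
  by (induction c arbitrary: K) auto

lemma Cons_in_stacks: "c # K \<in> stacks c K"
  by (cases c) auto

text \<open>Keeps the transitions inside the finite set of control states. \<open>K\<close> is
  arbitrary in the induction, since the first component of a sequence runs on top of a longer
  stack.\<close>

lemma stacks_closed:
  assumes "c # K' \<in> stacks P K"
  shows "next_cmds c r @ K' \<in> insert K (stacks P K)"
  using assms
proof (induction P arbitrary: K)
  case (CSeq a b)
  then show ?case using Cons_in_stacks by (auto dest!: CSeq.IH)
next
  case (CIf ts a b)
  then show ?case using Cons_in_stacks by (cases "holds ts r") (auto dest!: CIf.IH)
next
  case (CWhile ts a)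
  then show ?case using Cons_in_stacks by (auto dest!: CWhile.IH)
qed auto

lemma stacks_wf: "c # K' \<in> stacks P K \<Longrightarrow> cmd_wf k P \<Longrightarrow> cmd_wf k c"
  by (induction P arbitrary: K) auto

lemma cmd_wf_mono: "cmd_wf k c \<Longrightarrow> k \<le> l \<Longrightarrow> cmd_wf l c"
  by (induction c) (auto simp: subset_iff)

lemma holds_cong:
  assumes "fst ` set ts \<subseteq> {..<k}" "\<And>i. i < k \<Longrightarrow> r i = r' i"
  shows "holds ts r = holds ts r'"
  using assms by (auto simp: holds_def split_def image_subset_iff)

lemma next_cmds_cong:
  assumes "cmd_wf k c" "\<And>i. i < k \<Longrightarrow> r i = r' i"
  shows "next_cmds c r = next_cmds c r'"
  using assms holds_cong[of _ k r r'] by (cases c) auto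

lemma actions_cong:
  assumes "cmd_wf k c" "0 < k" "\<And>i. i < k \<Longrightarrow> r i = r' i"
  shows "actions c r = actions c r'"
  using assms by (cases c) auto

lemma actions_bound:
  assumes "cmd_wf k c" "0 < k" "\<And>i. i < k \<Longrightarrow> r i \<le> 2" "(i, w, m) \<in> set (actions c r)"
  shows "i < k" "w \<le> 2"
  using assms by (cases c; auto)+

lemma actions_fst: "(i, w, m) \<in> set (actions c r) \<Longrightarrow> (i', w', m') \<in> set (actions c r) \<Longrightarrow> i = i' \<and> m = m'"
  by (cases c) auto

lemma distinct_actions: "cmd_wf k c \<Longrightarrow> distinct (actions c r)"
  by (cases c) (auto simp: distinct_map inj_on_def)

lemma actions_nonempty: "cmd_wf k c \<Longrightarrow> actions c r \<noteq> []"
  by (cases c) auto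

section \<open>Stacks and stores as machine configurations\<close>

definition store_wf :: "nat \<Rightarrow> store \<Rightarrow> bool" where
  "store_wf k s \<longleftrightarrow> (\<forall>i < k. \<forall>z. snd (s i) z \<le> 2)"

definition tapes_of :: "nat \<Rightarrow> store \<Rightarrow> tape list" where
  "tapes_of k s = map s [0..<k]"

text \<open>\<open>computation_paths\<close> from an arbitrary configuration, as the induction along
  runs requires.\<close>

definition halting_paths :: "ntm \<Rightarrow> config \<Rightarrow> transition list set" where
  "halting_paths M C = {ts. \<exists>c. run M C ts c \<and> enabled M c = {}}"

lemma wf_machine:
  assumes "cmd_wf k P" "0 < k"
  shows "wf_ntm (machine k P)"
proof -
  have "\<forall>(q, as, q', bs, ds) \<in> delta (machine k P). q \<in> states (machine k P) \<and>
      q' \<in> states (machine k P) \<and> length as = k \<and> set as \<subseteq> {..2} \<and>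
      length bs = k \<and> set bs \<subseteq> {..2} \<and> length ds = k"
  proof safe
    fix q as q' bs ds
    assume "(q, as, q', bs, ds) \<in> delta (machine k P)"
    then obtain c K i w m where *: "c # K \<in> stacks P []" "length as = k" "set as \<subseteq> {..2}"
      "(i, w, m) \<in> set (actions c ((!) as))" "q = to_nat (c # K)"
      "q' = to_nat (next_cmds c ((!) as) @ K)" "bs = as[i := w]" "ds = (replicate k Stay)[i := m]"
      by (auto simp: machine_def transition_of_def)
    show "q \<in> states (machine k P)" "q' \<in> states (machine k P)"
      using * stacks_closed[OF *(1)] by (auto simp: machine_def)
    show "length as = k" "length bs = k" "length ds = k" using * by auto
    show "x \<le> 2" if "x \<in> set as" for x using * that by auto
    have "w \<le> 2"
      using actions_bound(2)[OF stacks_wf[OF *(1) assms(1)] assms(2) _ *(4)] *(2,3)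
      by (metis atMost_iff nth_mem subsetD)
    then show "x \<le> 2" if "x \<in> set bs" for x
      using * that set_update_subset_insert by fastforce
  qed
  moreover have "finite (states (machine k P))" "start (machine k P) \<in> states (machine k P)"
    "symbols (machine k P) = {..2}" "num_tapes (machine k P) = k"
    using Cons_in_stacks by (auto simp: machine_def finite_stacks)
  ultimately show ?thesis
    using assms(2) unfolding wf_ntm_def by (simp add: blank_def symbol_of_bit_def image_subset_iff)
qed

lemma enabled_Nil: "enabled (machine k P) (to_nat ([] :: cmd list), ts) = {}"
  by (auto simp: enabled_def machine_def transition_of_def)

lemma length_tapes_of [simp]: "length (tapes_of k s) = k"
  by (simp add: tapes_of_def)

lemma enabled_Cons:
  assumes "c # K \<in> stacks P []" "cmd_wf k P" "0 < k" "store_wf k s"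
  shows "enabled (machine k P) (to_nat (c # K), tapes_of k s) =
    transition_of k c K (map read_tape (tapes_of k s)) ` set (actions c (reads s))"
proof -
  let ?as = "map read_tape (tapes_of k s)"
  have r: "?as ! i = reads s i" if "i < k" for i
    using that by (simp add: reads_def tapes_of_def)
  have "cmd_wf k c" using stacks_wf assms by blast
  then have acts: "actions c ((!) ?as) = actions c (reads s)"
    using actions_cong assms(3) r by blast
  have as: "set ?as \<subseteq> {..2}" "length ?as = k"
    using assms(4) by (auto simp: store_wf_def tapes_of_def read_tape_def split_def)
  have "enabled (machine k P) (to_nat (c # K), tapes_of k s) =
      {t \<in> delta (machine k P). fst t = to_nat (c # K) \<and> fst (snd t) = ?as}"
    by (auto simp: enabled_def)
  moreover have "fst (transition_of k c K as a) = to_nat (c # K)"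
    "fst (snd (transition_of k c K as a)) = as" for c K as a
    by (simp_all add: transition_of_def split_def)
  moreover have "delta (machine k P) = {transition_of k c K as a | c K as a. c # K \<in> stacks P [] \<and>
      length as = k \<and> set as \<subseteq> {..2} \<and> a \<in> set (actions c ((!) as))}"
    by (simp add: machine_def)
  ultimately have "t \<in> enabled (machine k P) (to_nat (c # K), tapes_of k s) \<longleftrightarrow>
      t \<in> transition_of k c K ?as ` set (actions c ((!) ?as))" for t
    using assms(1) as by (fastforce simp del: split_paired_Ex split_paired_All set_map length_map)
  then have "enabled (machine k P) (to_nat (c # K), tapes_of k s) =
      transition_of k c K ?as ` set (actions c ((!) ?as))"
    by blast
  then show ?thesis using acts by simp
qed

text \<open>All actions of a command agree in tape and move, so two of its actions can differ only
  in the symbol written, which is visible at one position of the list written by the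
  transition.\<close>

lemma inj_on_transition_of:
  assumes "cmd_wf k c" "0 < k" "length as = k" "\<And>i. i < k \<Longrightarrow> r i \<le> 2"
  shows "inj_on (transition_of k c K as) (set (actions c r))"
proof (rule inj_onI)
  fix a a' :: "nat \<times> nat \<times> move"
  obtain i w m i' w' m' where a: "a = (i, w, m)" "a' = (i', w', m')" by (cases a, cases a')
  assume "a \<in> set (actions c r)" "a' \<in> set (actions c r)"
    "transition_of k c K as a = transition_of k c K as a'"
  then have *: "(i, w, m) \<in> set (actions c r)" "(i', w', m') \<in> set (actions c r)"
    "transition_of k c K as (i, w, m) = transition_of k c K as (i', w', m')"
    by (simp_all add: a)
  then have "i = i'" "m = m'" "i < k"
    using actions_fst[OF *(1,2)] actions_bound[OF assms(1,2,4) *(1)] by auto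
  moreover from this have "as[i := w] ! i = as[i := w'] ! i"
    using *(3) by (simp add: transition_of_def)
  ultimately show "a = a'" using assms(3) by (simp add: a)
qed

lemma fire_transition_of:
  assumes "cmd_wf k c" "0 < k" "a \<in> set (actions c (reads s))"
  shows "fire (transition_of k c K (map read_tape (tapes_of k s)) a) (q, tapes_of k s) =
    (to_nat (next_cmds c (reads s) @ K), tapes_of k (act a s))"
proof -
  obtain i w m where a: "a = (i, w, m)" by (cases a)
  let ?as = "map read_tape (tapes_of k s)"
  have nc: "next_cmds c ((!) ?as) = next_cmds c (reads s)"
    by (rule next_cmds_cong[OF assms(1)]) (simp add: reads_def tapes_of_def)
  have "map2 (\<lambda>t (b, d). update_tape t b d) (tapes_of k s)
      (zip (?as[i := w]) ((replicate k Stay)[i := m])) = tapes_of k (act a s)"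
    by (rule nth_equalityI)
      (auto simp: tapes_of_def nth_list_update act_def a update_tape_def read_tape_def
        split: prod.splits)
  then show ?thesis by (simp add: a fire_def transition_of_def nc)
qed

lemma store_wf_act:
  assumes "cmd_wf k c" "0 < k" "store_wf k s" "a \<in> set (actions c (reads s))"
  shows "store_wf k (act a s)"
proof -
  obtain i w m where a: "a = (i, w, m)" by (cases a)
  have "reads s i \<le> 2" if "i < k" for i
    using assms(3) that by (auto simp: store_wf_def reads_def read_tape_def split_def)
  then have "w \<le> 2" using actions_bound assms a by blast
  then show ?thesis
    using assms(3) by (auto simp: store_wf_def a act_def update_tape_def split_def)
qed

section \<open>Counting halting paths\<close>

lemma run_Nil_iff: "run M C [] C' \<longleftrightarrow> C' = C"
  by (auto elim: run.cases intro: run.intros)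

lemma run_Cons_iff: "run M C (t # ts) C' \<longleftrightarrow> t \<in> enabled M C \<and> run M (fire t C) ts C'"
  by (auto elim: run.cases intro: run.intros)

lemma Nil_in_halting_paths: "[] \<in> halting_paths M C \<longleftrightarrow> enabled M C = {}"
  by (simp add: halting_paths_def run_Nil_iff del: split_paired_Ex)

lemma Cons_in_halting_paths:
  "t # ts \<in> halting_paths M C \<longleftrightarrow> t \<in> enabled M C \<and> ts \<in> halting_paths M (fire t C)"
  by (simp add: halting_paths_def run_Cons_iff del: split_paired_Ex)

lemma halting_paths_halted:
  assumes "enabled M C = {}"
  shows "halting_paths M C = {[]}"
proof -
  have "ts \<in> halting_paths M C \<longleftrightarrow> ts = []" for ts
    using assms by (cases ts) (simp_all only: Nil_in_halting_paths Cons_in_halting_paths, simp_all)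
  then show ?thesis by blast
qed

lemma halting_paths_step:
  assumes "enabled M C \<noteq> {}"
  shows "halting_paths M C = (\<Union>t \<in> enabled M C. (#) t ` halting_paths M (fire t C))"
proof -
  have "ts \<in> halting_paths M C \<longleftrightarrow> ts \<in> (\<Union>t \<in> enabled M C. (#) t ` halting_paths M (fire t C))" for ts
  proof (cases ts)
    case Nil
    then show ?thesis using assms Nil_in_halting_paths by blast
  next
    case (Cons t ts')
    then show ?thesis using Cons_in_halting_paths by blast
  qed
  then show ?thesis by blast
qed

text \<open>Transfers the abstract count to the machine. Distinct actions yield distinct first
  transitions, so the halting paths split disjointly, and the sum over the list of actions is a sum
  over a set.\<close>

lemma tree_halting_paths:
  assumes "tree q s T N" "cmd_wf k P" "0 < k" "store_wf k s" "q \<in> insert [] (stacks P [])"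
  defines "M \<equiv> machine k P"
  shows "(\<forall>ts c. run M (to_nat q, tapes_of k s) ts c \<longrightarrow> length ts \<le> T) \<and>
    finite (halting_paths M (to_nat q, tapes_of k s)) \<and>
    card (halting_paths M (to_nat q, tapes_of k s)) = N"
  using assms(1,4,5)
proof (induction rule: tree.induct)
  case (tree_Nil s T)
  have "length ts \<le> T" if "run M (to_nat ([] :: cmd list), tapes_of k s) ts c" for ts c
    using that by (cases ts) (simp_all add: run_Cons_iff enabled_Nil M_def)
  moreover have "halting_paths M (to_nat ([] :: cmd list), tapes_of k s) = {[]}"
    by (rule halting_paths_halted) (simp add: enabled_Nil M_def)
  ultimately show ?case by auto
next
  case (tree_Cons c s K T N)
  let ?C = "(to_nat (c # K), tapes_of k s)"
  let ?A = "set (actions c (reads s))"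
  let ?f = "transition_of k c K (map read_tape (tapes_of k s))"
  let ?q = "next_cmds c (reads s) @ K"
  have cK: "c # K \<in> stacks P []" using tree_Cons.prems by auto
  have wf: "cmd_wf k c" using stacks_wf[OF cK assms(2)] .
  have en: "enabled M ?C = ?f ` ?A"
    using enabled_Cons[OF cK assms(2,3) tree_Cons.prems(1)] by (simp add: M_def)
  have fire: "fire (?f a) ?C = (to_nat ?q, tapes_of k (act a s))" if "a \<in> ?A" for a
    using fire_transition_of[OF wf assms(3) that] .
  have IH: "(\<forall>ts c. run M (to_nat ?q, tapes_of k (act a s)) ts c \<longrightarrow> length ts \<le> T) \<and>
    finite (halting_paths M (to_nat ?q, tapes_of k (act a s))) \<and>
    card (halting_paths M (to_nat ?q, tapes_of k (act a s))) = N a" if "a \<in> ?A" for a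
    using tree_Cons.IH[OF that] store_wf_act[OF wf assms(3) tree_Cons.prems(1) that]
      stacks_closed[OF cK] by blast
  have "reads s i \<le> 2" if "i < k" for i
    using tree_Cons.prems(1) that
    by (auto simp: store_wf_def reads_def read_tape_def split_def)
  then have inj: "inj_on ?f ?A"
    by (intro inj_on_transition_of[OF wf assms(3)]) auto
  have bound: "length ts \<le> Suc T" if "run M ?C ts c'" for ts c'
  proof (cases ts)
    case (Cons t ts')
    then obtain a where a: "a \<in> ?A" "t = ?f a" and "run M (fire t ?C) ts' c'"
      using \<open>run M ?C ts c'\<close> by (auto simp only: run_Cons_iff en)
    then have "length ts' \<le> T" using IH[OF a(1)] fire[OF a(1)] by metis
    then show ?thesis by (simp add: Cons)
  qed simp
  have ne: "enabled M ?C \<noteq> {}" using actions_nonempty[OF wf] by (simp add: en)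
  have hp: "halting_paths M ?C =
      (\<Union>a \<in> ?A. (#) (?f a) ` halting_paths M (to_nat ?q, tapes_of k (act a s)))"
  proof -
    have "halting_paths M ?C = (\<Union>a \<in> ?A. (#) (?f a) ` halting_paths M (fire (?f a) ?C))"
      unfolding halting_paths_step[OF ne] en by blast
    also have "\<dots> = (\<Union>a \<in> ?A. (#) (?f a) ` halting_paths M (to_nat ?q, tapes_of k (act a s)))"
      by (rule SUP_cong) (simp_all only: fire)
    finally show ?thesis .
  qed
  have "card (halting_paths M ?C) =
      (\<Sum>a \<in> ?A. card ((#) (?f a) ` halting_paths M (to_nat ?q, tapes_of k (act a s))))"
    unfolding hp
  proof (rule card_UN_disjoint)
    show "\<forall>i \<in> ?A. \<forall>j \<in> ?A. i \<noteq> j \<longrightarrow>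
      (#) (?f i) ` halting_paths M (to_nat ?q, tapes_of k (act i s)) \<inter>
      (#) (?f j) ` halting_paths M (to_nat ?q, tapes_of k (act j s)) = {}"
      using inj by (auto dest: inj_onD)
  qed (simp_all add: IH)
  also have "\<dots> = (\<Sum>a \<in> ?A. N a)"
    using IH by (intro sum.cong) (auto simp: card_image)
  also have "\<dots> = (\<Sum>a\<leftarrow>actions c (reads s). N a)"
    using distinct_actions[OF wf] by (simp add: sum_list_distinct_conv_sum_set)
  finally have "card (halting_paths M ?C) = (\<Sum>a\<leftarrow>actions c (reads s). N a)" .
  moreover have "finite (halting_paths M ?C)" unfolding hp using IH by auto
  ultimately show ?case using bound by blast
qed

section \<open>Compositional rules for executions\<close>

lemma tree_mono: "tree K s T N \<Longrightarrow> T \<le> T' \<Longrightarrow> tree K s T' N"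
proof (induction arbitrary: T' rule: tree.induct)
  case (tree_Cons c s K T N)
  then obtain T'' where "T' = Suc T''" "T \<le> T''" by (cases T') auto
  then show ?case using tree_Cons.IH by (auto intro: tree.tree_Cons)
qed (rule tree.tree_Nil)

text \<open>\<open>exec c s T ss\<close>: within \<open>T\<close> steps, every execution of \<open>c\<close> from \<open>s\<close> terminates, and
  \<open>ss\<close> lists the final stores of these executions.\<close>

definition exec :: "cmd \<Rightarrow> store \<Rightarrow> nat \<Rightarrow> store list \<Rightarrow> bool" where
  "exec c s T ss \<longleftrightarrow> (\<forall>K T' N. (\<forall>s' \<in> set ss. tree K s' T' (N s')) \<longrightarrow>
     tree (c # K) s (T + T') (\<Sum>s'\<leftarrow>ss. N s'))"

lemma exec_mono: "exec c s T ss \<Longrightarrow> T \<le> T' \<Longrightarrow> exec c s T' ss"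
  unfolding exec_def by (meson add_le_mono1 tree_mono)

lemma act_skip [simp]: "act (i, reads s i, Stay) s = s"
  by (auto simp: act_def reads_def update_tape_def read_tape_def split: prod.splits)

lemma tree_skip:
  assumes "actions c (reads s) = [(0, reads s 0, Stay)]" "tree (next_cmds c (reads s) @ K) s T N"
  shows "tree (c # K) s (Suc T) N"
  using tree_Cons[of c s K T "\<lambda>_. N"] assms by simp

lemma exec_Move: "exec (CMove i m) s 1 [s(i := (fst (s i) + offset m, snd (s i)))]"
proof -
  have "act (i, reads s i, m) s = s(i := (fst (s i) + offset m, snd (s i)))"
    by (auto simp: act_def reads_def update_tape_def read_tape_def split: prod.splits)
  then show ?thesis
    using tree_Cons[of "CMove i m" s] by (force simp: exec_def)
qed

lemma exec_Write:
  "exec (CWrite i ws) s 1 (map (\<lambda>w. s(i := (fst (s i), (snd (s i))(fst (s i) := w)))) ws)"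
  unfolding exec_def
proof (intro allI impI)
  fix K T' N
  let ?u = "\<lambda>w. s(i := (fst (s i), (snd (s i))(fst (s i) := w)))"
  assume *: "\<forall>s' \<in> set (map ?u ws). tree K s' T' (N s')"
  have act: "act (i, w, Stay) s = ?u w" for w
    by (auto simp: act_def update_tape_def split: prod.splits)
  have "tree (CWrite i ws # K) s (Suc T') (\<Sum>a\<leftarrow>actions (CWrite i ws) (reads s). N (act a s))"
    by (rule tree_Cons) (use * act in auto)
  then show "tree (CWrite i ws # K) s (1 + T') (\<Sum>s'\<leftarrow>map ?u ws. N s')"
    by (simp add: act o_def)
qed

text \<open>\<open>exec\<close> quantifies over the remaining stack and the counts behind it; taking
  \<open>b # K\<close> as the stack that remains after \<open>a\<close> composes the two. The extra
  step replaces the sequence by its components.\<close>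

lemma exec_Seq:
  assumes "exec a s T ss" "\<And>s'. s' \<in> set ss \<Longrightarrow> exec b s' T' (F s')"
  shows "exec (CSeq a b) s (Suc (T + T')) (concat (map F ss))"
  unfolding exec_def
proof (intro allI impI)
  fix K T'' N
  assume *: "\<forall>s' \<in> set (concat (map F ss)). tree K s' T'' (N s')"
  have "tree (b # K) s' (T' + T'') (\<Sum>s''\<leftarrow>F s'. N s'')" if "s' \<in> set ss" for s'
    using assms(2)[OF that] * that by (auto simp: exec_def)
  then have "tree (a # b # K) s (T + (T' + T'')) (\<Sum>s'\<leftarrow>ss. \<Sum>s''\<leftarrow>F s'. N s'')"
    using assms(1) by (auto simp: exec_def)
  then have "tree (CSeq a b # K) s (Suc (T + (T' + T''))) (\<Sum>s'\<leftarrow>ss. \<Sum>s''\<leftarrow>F s'. N s'')"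
    by (intro tree_skip) auto
  moreover have "(\<Sum>s'\<leftarrow>ss. \<Sum>s''\<leftarrow>F s'. N s'') = (\<Sum>s'\<leftarrow>concat (map F ss). N s')"
    by (induction ss) auto
  ultimately show "tree (CSeq a b # K) s (Suc (T + T') + T'') (\<Sum>s'\<leftarrow>concat (map F ss). N s')"
    by (simp add: add.assoc)
qed

lemma exec_Seq1:
  assumes "exec a s T [s']" "exec b s' T' ss"
  shows "exec (CSeq a b) s (Suc (T + T')) ss"
  using exec_Seq[OF assms(1), of b T' "\<lambda>_. ss"] assms(2) by simp

lemma exec_If:
  assumes "exec (if holds ts (reads s) then a else b) s T ss"
  shows "exec (CIf ts a b) s (Suc T) ss"
  using assms by (auto simp: exec_def intro!: tree_skip)

lemma exec_While_False:
  assumes "\<not> holds ts (reads s)"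
  shows "exec (CWhile ts a) s 1 [s]"
  using assms by (auto simp: exec_def intro!: tree_skip)

lemma exec_While_True:
  assumes "holds ts (reads s)" "exec a s T ss" "\<And>s'. s' \<in> set ss \<Longrightarrow> exec (CWhile ts a) s' T' (F s')"
  shows "exec (CWhile ts a) s (Suc (T + T')) (concat (map F ss))"
  unfolding exec_def
proof (intro allI impI)
  fix K T'' N
  assume "\<forall>s' \<in> set (concat (map F ss)). tree K s' T'' (N s')"
  then have "tree (CSeq a (CWhile ts a) # K) s (Suc (T + T') + T'') (\<Sum>s'\<leftarrow>concat (map F ss). N s')"
    using exec_Seq[OF assms(2,3)] unfolding exec_def by blast
  \<comment> \<open>An iteration pushes the same commands as a sequence of body and loop, so
    inverting the first step of that sequence gives the tree below the loop.\<close>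
  then have "tree (a # CWhile ts a # K) s (T + T' + T'') (\<Sum>s'\<leftarrow>concat (map F ss). N s')"
    by (cases rule: tree.cases) auto
  then show "tree (CWhile ts a # K) s (Suc (T + T') + T'') (\<Sum>s'\<leftarrow>concat (map F ss). N s')"
    using assms(1) by (auto intro!: tree_skip)
qed

lemma exec_While_loop:
  assumes "\<And>j. j < m \<Longrightarrow> holds ts (reads (S j))" "\<not> holds ts (reads (S m))"
    "\<And>j. j < m \<Longrightarrow> exec c (S j) T [S (Suc j)]"
  shows "exec (CWhile ts c) (S 0) (Suc (m * Suc T)) [S m]"
  using assms
proof (induction m arbitrary: S)
  case 0
  then show ?case using exec_While_False by force
next
  case (Suc m)
  have "exec (CWhile ts c) (S (Suc 0)) (Suc (m * Suc T)) [S (Suc m)]"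
    using Suc.IH[of "\<lambda>j. S (Suc j)"] Suc.prems by simp
  then have "exec (CWhile ts c) (S 0) (Suc (T + Suc (m * Suc T))) (concat (map (\<lambda>_. [S (Suc m)]) [S (Suc 0)]))"
    using Suc.prems(1,3)[of 0] by (intro exec_While_True) auto
  then show ?case by (simp add: add_ac)
qed

lemma exec_tree:
  assumes "exec c s T ss"
  shows "tree [c] s T (length ss)"
proof -
  have "tree [c] s (T + 0) (\<Sum>s'\<leftarrow>ss. 1)"
    using assms[unfolded exec_def, rule_format, where K = "[]" and T' = 0 and N = "\<lambda>_. 1"] tree_Nil
    by blast
  then show ?thesis by (simp add: sum_list_triv)
qed

section \<open>Loop programs\<close>

text \<open>Loop programs run on numbered data tapes and on variables with values below \<open>n\<close>. A loop
  binds its variable and lets it run from 0 to \<open>n - 1\<close>. \<open>PEq i i' p q\<close> and \<open>PLe i i' p q\<close> branch on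
  a comparison of two variables, \<open>PIf j a p q\<close> on the symbol under the head of data tape \<open>j\<close>.\<close>

datatype prog =
    PMove nat move
  | PWrite nat "nat list"
  | PSeq prog prog
  | PIf nat nat prog prog
  | PEq nat nat prog prog
  | PLe nat nat prog prog
  | PFor nat prog

text \<open>The fold in the list monad: each element maps a state to the list of its possible
  successors.\<close>

primrec iter :: "('a \<Rightarrow> 'b \<Rightarrow> 'b list) \<Rightarrow> 'a list \<Rightarrow> 'b \<Rightarrow> 'b list" where
  "iter f [] D = [D]"
| "iter f (a # as) D = concat (map (iter f as) (f a D))"

primrec sem :: "nat \<Rightarrow> prog \<Rightarrow> (nat \<Rightarrow> nat) \<Rightarrow> store \<Rightarrow> store list" where
  "sem n (PMove j m) v D = [D(j := (fst (D j) + offset m, snd (D j)))]"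
| "sem n (PWrite j ws) v D = map (\<lambda>w. D(j := (fst (D j), (snd (D j))(fst (D j) := w)))) ws"
| "sem n (PSeq p q) v D = concat (map (sem n q v) (sem n p v D))"
| "sem n (PIf j a p q) v D = (if reads D j = a then sem n p v D else sem n q v D)"
| "sem n (PEq i i' p q) v D = (if v i = v i' then sem n p v D else sem n q v D)"
| "sem n (PLe i i' p q) v D = (if v i \<le> v i' then sem n p v D else sem n q v D)"
| "sem n (PFor i p) v D = iter (\<lambda>a. sem n p (v(i := a))) [0..<n] D"

primrec loop_vars :: "prog \<Rightarrow> nat set" where
  "loop_vars (PMove j m) = {}"
| "loop_vars (PWrite j ws) = {}"
| "loop_vars (PSeq p q) = loop_vars p \<union> loop_vars q"
| "loop_vars (PIf j a p q) = loop_vars p \<union> loop_vars q"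
| "loop_vars (PEq i i' p q) = loop_vars p \<union> loop_vars q"
| "loop_vars (PLe i i' p q) = loop_vars p \<union> loop_vars q"
| "loop_vars (PFor i p) = insert i (loop_vars p)"

text \<open>A nested loop over the same variable would rewind its head and so destroy the value of
  the outer loop, which \<open>sem\<close> preserves.\<close>

primrec prog_wf :: "prog \<Rightarrow> bool" where
  "prog_wf (PMove j m) \<longleftrightarrow> True"
| "prog_wf (PWrite j ws) \<longleftrightarrow> distinct ws \<and> ws \<noteq> [] \<and> set ws \<subseteq> {..2}"
| "prog_wf (PSeq p q) \<longleftrightarrow> prog_wf p \<and> prog_wf q"
| "prog_wf (PIf j a p q) \<longleftrightarrow> prog_wf p \<and> prog_wf q"
| "prog_wf (PEq i i' p q) \<longleftrightarrow> prog_wf p \<and> prog_wf q"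
| "prog_wf (PLe i i' p q) \<longleftrightarrow> prog_wf p \<and> prog_wf q"
| "prog_wf (PFor i p) \<longleftrightarrow> prog_wf p \<and> i \<notin> loop_vars p"

text \<open>Data tape \<open>j\<close> is tape \<open>2 j\<close> of the machine. A variable \<open>i\<close> is the head position of tape
  \<open>2 i + 3\<close>, whose cells \<open>0, \<dots>, n - 1\<close> are marked. Tape 1 is a counter, marked at its zero.\<close>

definition marks :: "nat \<Rightarrow> int \<Rightarrow> nat" where
  "marks n z = (if 0 \<le> z \<and> z < int n then 1 else 0)"

definition zero_mark :: "int \<Rightarrow> nat" where
  "zero_mark z = (if z = 0 then 2 else 0)"

definition layout :: "nat \<Rightarrow> (nat \<Rightarrow> nat) \<Rightarrow> store \<Rightarrow> store" where
  "layout n v D k = (if k = 1 then (0, zero_mark) else if even k then D (k div 2)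
     else (int (v ((k - 3) div 2)), marks n))"

text \<open>A left inverse of \<open>layout\<close>. It allows the continuations in the rules for
  sequences and loops to be written as functions of the intermediate store.\<close>

definition data_tapes :: "store \<Rightarrow> store" where
  "data_tapes s j = s (2 * j)"

definition restore :: "nat \<Rightarrow> nat \<Rightarrow> cmd" where
  "restore x y = CWhile [(1, 0)] (CSeq (CMove 1 Lft) (CSeq (CMove x Rgt) (CMove y Rgt)))"

text \<open>Both heads move left until one of them leaves the marked cells. Since the counter records
  the number of moves, they can be moved back afterwards.\<close>

definition compare :: "nat \<Rightarrow> nat \<Rightarrow> (nat \<times> nat) list \<Rightarrow> cmd \<Rightarrow> cmd \<Rightarrow> cmd" where
  "compare x y ts a b =
     CSeq (CWhile [(x, 1), (y, 1)] (CSeq (CMove x Lft) (CSeq (CMove y Lft) (CMove 1 Rgt))))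
       (CIf ts (CSeq (restore x y) a) (CSeq (restore x y) b))"

text \<open>The head enters the marked cells from cell \<open>n\<close> and leaves them at cell -1,
  hence the moves before and after the loop.\<close>

definition rewind :: "nat \<Rightarrow> cmd" where
  "rewind x = CSeq (CMove x Lft) (CSeq (CWhile [(x, 1)] (CMove x Lft)) (CMove x Rgt))"

text \<open>After the walk of \<open>compare\<close>, the head of \<open>i\<close> is off the marks
  iff \<open>v i \<le> v i'\<close>, and both heads are iff the values are equal. A variable
  compared with itself is treated separately because its head would move twice in each
  round.\<close>

primrec compile :: "prog \<Rightarrow> cmd" where
  "compile (PMove j m) = CMove (2 * j) m"
| "compile (PWrite j ws) = CWrite (2 * j) ws"
| "compile (PSeq p q) = CSeq (compile p) (compile q)"
| "compile (PIf j a p q) = CIf [(2 * j, a)] (compile p) (compile q)"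
| "compile (PEq i i' p q) = (if i = i' then compile p else
     compare (2 * i + 3) (2 * i' + 3) [(2 * i + 3, 0), (2 * i' + 3, 0)] (compile p) (compile q))"
| "compile (PLe i i' p q) = (if i = i' then compile p else
     compare (2 * i + 3) (2 * i' + 3) [(2 * i + 3, 0)] (compile p) (compile q))"
| "compile (PFor i p) =
     CSeq (CWhile [(2 * i + 3, 1)] (CSeq (compile p) (CMove (2 * i + 3) Rgt))) (rewind (2 * i + 3))"

text \<open>An upper bound: a branch is charged for both alternatives. In a comparison, the walk and
  the way back take at most \<open>n\<close> rounds of six steps each, hence
  \<open>12 * n\<close>.\<close>

primrec time :: "nat \<Rightarrow> prog \<Rightarrow> nat" where
  "time n (PMove j m) = 1"
| "time n (PWrite j ws) = 1"
| "time n (PSeq p q) = time n p + time n q + 1"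
| "time n (PIf j a p q) = time n p + time n q + 1"
| "time n (PEq i i' p q) = time n p + time n q + (12 * n + 6)"
| "time n (PLe i i' p q) = time n p + time n q + (12 * n + 6)"
| "time n (PFor i p) = n * (time n p + 5) + 10"

section \<open>Correctness of the compilation\<close>

lemma layout_simps [simp]:
  "layout n v D (2 * j) = D j" "layout n v D (Suc 0) = (0, zero_mark)"
  "layout n v D (2 * i + 3) = (int (v i), marks n)"
  by (simp_all add: layout_def)

lemma layout_data: "(layout n v D)(2 * j := t) = layout n v (D(j := t))"
  by (auto simp: layout_def fun_eq_iff)

lemma layout_var: "(layout n v D)(2 * i + 3 := (int a, marks n)) = layout n (v(i := a)) D"
  by (auto simp: layout_def fun_eq_iff elim!: oddE)

lemma data_tapes_layout [simp]: "data_tapes (layout n v D) = D"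
  by (simp add: data_tapes_def fun_eq_iff)

lemma exec_Move_to: "s' = s(i := (fst (s i) + offset m, snd (s i))) \<Longrightarrow> exec (CMove i m) s 1 [s']"
  using exec_Move by simp

lemma exec_rewind:
  assumes "s x = (int n, marks n)"
  shows "exec (rewind x) s (2 * n + 5) [s(x := (0, marks n))]"
proof -
  let ?S = "\<lambda>j. s(x := (int n - 1 - int j, marks n))"
  have "exec (CWhile [(x, 1)] (CMove x Lft)) (?S 0) (Suc (n * Suc 1)) [?S n]"
  proof (rule exec_While_loop[where S = ?S])
    show "exec (CMove x Lft) (?S j) 1 [?S (Suc j)]" for j
      by (rule exec_Move_to) auto
    show "holds [(x, 1)] (reads (?S j))" if "j < n" for j
      using that by (auto simp: holds_def reads_def read_tape_def marks_def)
    show "\<not> holds [(x, 1)] (reads (?S n))"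
      by (auto simp: holds_def reads_def read_tape_def marks_def)
  qed
  moreover have "exec (CMove x Lft) s 1 [?S 0]"
    using assms by (intro exec_Move_to) auto
  moreover have "exec (CMove x Rgt) (?S n) 1 [s(x := (0, marks n))]"
    by (intro exec_Move_to) auto
  ultimately have "exec (rewind x) s (Suc (1 + Suc (Suc (n * Suc 1) + 1))) [s(x := (0, marks n))]"
    unfolding rewind_def by (meson exec_Seq1)
  then show ?thesis by (rule exec_mono) simp
qed

lemma exec_compare:
  assumes "x \<noteq> y" "x \<noteq> 1" "y \<noteq> 1" "s 1 = (0, zero_mark)"
    "s x = (int a, marks n)" "s y = (int b, marks n)" "a < n" "b < n"
    and ts: "\<And>r. r x = marks n (int a - int (min a b) - 1) \<Longrightarrow>
      r y = marks n (int b - int (min a b) - 1) \<Longrightarrow> holds ts r \<longleftrightarrow> Q"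
    and P: "exec (if Q then c else d) s T ss"
  shows "exec (compare x y ts c d) s (T + (12 * n + 6)) ss"
proof -
  let ?S = "\<lambda>j. s(1 := (int j, zero_mark), x := (int a - int j, marks n), y := (int b - int j, marks n))"
  \<comment> \<open>The smaller head needs one round more than its value to reach cell -1.\<close>
  define m where "m = Suc (min a b)"
  have mn: "m \<le> n" using assms(7) by (simp add: m_def)
  have S0: "?S 0 = s" using assms by (auto simp: fun_eq_iff)
  have "exec (CWhile [(x, 1), (y, 1)] (CSeq (CMove x Lft) (CSeq (CMove y Lft) (CMove 1 Rgt))))
      (?S 0) (Suc (m * Suc (Suc (1 + Suc (1 + 1))))) [?S m]"
  proof (rule exec_While_loop[where S = ?S])
    show "exec (CSeq (CMove x Lft) (CSeq (CMove y Lft) (CMove 1 Rgt))) (?S j)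
        (Suc (1 + Suc (1 + 1))) [?S (Suc j)]" for j
      by (rule exec_Seq1[OF exec_Move exec_Seq1[OF exec_Move exec_Move_to]])
        (use assms in \<open>auto simp: fun_eq_iff\<close>)
  qed (use assms in \<open>auto simp: holds_def reads_def read_tape_def marks_def m_def\<close>)
  \<comment> \<open>The way back runs through the same stores in reverse, so the loop rule is
    applied to \<open>?S (m - j)\<close>; it stops at the zero mark of the counter.\<close>
  moreover have "exec (restore x y) (?S (m - 0)) (Suc (m * Suc (Suc (1 + Suc (1 + 1))))) [?S (m - m)]"
    unfolding restore_def
  proof (rule exec_While_loop[where S = "\<lambda>j. ?S (m - j)"])
    fix j assume "j < m"
    then obtain l where l: "m - j = Suc l" "m - Suc j = l" by (metis Suc_diff_Suc)
    show "exec (CSeq (CMove 1 Lft) (CSeq (CMove x Rgt) (CMove y Rgt))) (?S (m - j))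
        (Suc (1 + Suc (1 + 1))) [?S (m - Suc j)]"
      unfolding l
      by (rule exec_Seq1[OF exec_Move exec_Seq1[OF exec_Move exec_Move_to]])
        (use assms in \<open>auto simp: fun_eq_iff\<close>)
  qed (use assms in \<open>auto simp: holds_def reads_def read_tape_def zero_mark_def\<close>)
  then have R: "exec (restore x y) (?S m) (Suc (m * Suc (Suc (1 + Suc (1 + 1))))) [s]"
    using S0 by simp
  have "holds ts (reads (?S m)) \<longleftrightarrow> Q"
    using assms(1) by (intro ts) (auto simp: reads_def read_tape_def m_def algebra_simps)
  then have "exec (CIf ts (CSeq (restore x y) c) (CSeq (restore x y) d)) (?S m)
      (Suc (Suc (Suc (m * Suc (Suc (1 + Suc (1 + 1)))) + T))) ss"
    using exec_Seq1[OF R P] by (intro exec_If) (auto split: if_splits)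
  ultimately have "exec (compare x y ts c d) s (Suc (Suc (m * Suc (Suc (1 + Suc (1 + 1)))) +
      (Suc (Suc (Suc (m * Suc (Suc (1 + Suc (1 + 1)))) + T))))) ss"
    unfolding compare_def S0 by (rule exec_Seq1)
  then show ?thesis by (rule exec_mono) (use mn in simp)
qed

text \<open>Induction on the number of values left. The loop ends with the head on the first
  unmarked cell, hence \<open>v(i := n)\<close>, which \<open>rewind\<close> has to undo.\<close>

lemma exec_For_loop:
  assumes "\<And>a D. a < n \<Longrightarrow>
      exec c (layout n (v(i := a)) D) T (map (layout n (v(i := a))) (f a D))" "a \<le> n"
  shows "exec (CWhile [(2 * i + 3, 1)] (CSeq c (CMove (2 * i + 3) Rgt))) (layout n (v(i := a)) D)
    (Suc ((n - a) * (T + 3))) (map (layout n (v(i := n))) (iter f [a..<n] D))"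
  using assms(2)
proof (induction "n - a" arbitrary: a D)
  case 0
  then have a: "a = n" by simp
  have "\<not> holds [(2 * i + 3, 1)] (reads (layout n (v(i := n)) D))"
    by (simp add: holds_def reads_def read_tape_def marks_def)
  from exec_While_False[OF this, of "CSeq c (CMove (2 * i + 3) Rgt)"] show ?case
    unfolding a by (simp only: upt_conv_Nil le_refl iter.simps list.map diff_self_eq_0 mult_0 One_nat_def)
next
  case (Suc k)
  let ?w = "CWhile [(2 * i + 3, 1)] (CSeq c (CMove (2 * i + 3) Rgt))"
  let ?L = "\<lambda>a. layout n (v(i := a))"
  have a: "a < n" using Suc.hyps(2) by simp
  have "exec (CMove (2 * i + 3) Rgt) s' 1 [?L (Suc a) (data_tapes s')]"
    if s'_in: "s' \<in> set (map (?L a) (f a D))" for s'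
  proof (rule exec_Move_to)
    obtain D' where s': "s' = ?L a D'" using s'_in by auto
    show "?L (Suc a) (data_tapes s') = s'(2 * i + 3 :=
        (fst (s' (2 * i + 3)) + offset Rgt, snd (s' (2 * i + 3))))"
      unfolding s' using layout_var[of n "v(i := a)" D' i "Suc a"] by (simp add: add.commute[of "int a" 1])
  qed
  from exec_Seq[OF assms(1)[OF a] this]
  have body: "exec (CSeq c (CMove (2 * i + 3) Rgt)) (?L a D) (Suc (T + 1)) (map (?L (Suc a)) (f a D))"
    by (simp add: o_def concat_map_singleton)
  have "exec ?w s' (Suc ((n - Suc a) * (T + 3)))
      (map (?L n) (iter f [Suc a..<n] (data_tapes s')))"
    if "s' \<in> set (map (?L (Suc a)) (f a D))" for s'
    using that Suc.hyps(1)[of "Suc a"] Suc.hyps(2) a by auto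
  from exec_While_True[OF _ body this]
  have "exec ?w (?L a D) (Suc (Suc (T + 1) + Suc ((n - Suc a) * (T + 3))))
      (map (?L n) (iter f [a..<n] D))"
    using a by (simp add: holds_def reads_def read_tape_def marks_def upt_conv_Cons
        map_concat o_def)
  moreover have "Suc (Suc (T + 1) + Suc ((n - Suc a) * (T + 3))) = Suc ((n - a) * (T + 3))"
    using a by (simp add: Suc_diff_Suc[symmetric])
  ultimately show ?case by (simp only:)
qed

text \<open>Loops start without a rewind, so the heads of the loop variables have to stand at 0 on
  entry; every loop rewinds at its end and thereby reestablishes this.\<close>

lemma exec_compile:
  assumes "prog_wf p" "\<And>i. v i < n" "\<And>i. i \<in> loop_vars p \<Longrightarrow> v i = 0"
  shows "exec (compile p) (layout n v D) (time n p) (map (layout n v) (sem n p v D))"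
  using assms
proof (induction p arbitrary: v D)
  case (PMove j m)
  have "exec (CMove (2 * j) m) (layout n v D) 1
      [layout n v (D(j := (fst (D j) + offset m, snd (D j))))]"
    by (rule exec_Move_to) (simp add: layout_data)
  then show ?case by simp
next
  case (PWrite j ws)
  show ?case using exec_Write[of "2 * j" ws "layout n v D"] by (simp add: layout_data o_def)
next
  case (PSeq p q)
  have "exec (compile q) s' (time n q) (map (layout n v) (sem n q v (data_tapes s')))"
    if "s' \<in> set (map (layout n v) (sem n p v D))" for s'
    using that PSeq.IH(2)[of v] PSeq.prems by auto
  from exec_Seq[OF PSeq.IH(1) this] show ?case
    using PSeq.prems by (simp add: map_concat o_def)
next
  case (PIf j a p q)
  have "exec (if reads D j = a then compile p else compile q) (layout n v D) (time n p + time n q)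
      (map (layout n v) (sem n (PIf j a p q) v D))"
    using PIf.prems
    by (auto intro: exec_mono[OF PIf.IH(1)[of v D]] exec_mono[OF PIf.IH(2)[of v D]])
  then show ?case using exec_If[of "[(2 * j, a)]"] by (simp add: holds_def reads_def)
next
  case (PEq i i' p q)
  have *: "exec (if v i = v i' then compile p else compile q) (layout n v D) (time n p + time n q)
      (map (layout n v) (sem n (PEq i i' p q) v D))"
    using PEq.prems
    by (auto intro: exec_mono[OF PEq.IH(1)[of v D]] exec_mono[OF PEq.IH(2)[of v D]])
  show ?case
  proof (cases "i = i'")
    case True
    then show ?thesis using exec_mono[OF *] by simp
  next
    case False
    have "exec (compare (2 * i + 3) (2 * i' + 3) [(2 * i + 3, 0), (2 * i' + 3, 0)] (compile p) (compile q))
      (layout n v D) ((time n p + time n q) + (12 * n + 6)) (map (layout n v) (sem n (PEq i i' p q) v D))"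
      using False PEq.prems(2)[of i] PEq.prems(2)[of i']
      by (intro exec_compare[OF _ _ _ _ layout_simps(3) layout_simps(3) _ _ _ *])
        (auto simp: holds_def marks_def)
    then show ?thesis using False by simp
  qed
next
  case (PLe i i' p q)
  have *: "exec (if v i \<le> v i' then compile p else compile q) (layout n v D) (time n p + time n q)
      (map (layout n v) (sem n (PLe i i' p q) v D))"
    using PLe.prems
    by (auto intro: exec_mono[OF PLe.IH(1)[of v D]] exec_mono[OF PLe.IH(2)[of v D]])
  show ?case
  proof (cases "i = i'")
    case True
    then show ?thesis using exec_mono[OF *] by simp
  next
    case False
    have "exec (compare (2 * i + 3) (2 * i' + 3) [(2 * i + 3, 0)] (compile p) (compile q))
      (layout n v D) ((time n p + time n q) + (12 * n + 6)) (map (layout n v) (sem n (PLe i i' p q) v D))"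
      using False PLe.prems(2)[of i] PLe.prems(2)[of i']
      by (intro exec_compare[OF _ _ _ _ layout_simps(3) layout_simps(3) _ _ _ *])
        (auto simp: holds_def marks_def)
    then show ?thesis using False by simp
  qed
next
  case (PFor i p)
  let ?x = "2 * i + 3"
  have v: "v(i := 0) = v" using PFor.prems(3) by auto
  have "exec (compile p) (layout n (v(i := a)) D) (time n p)
      (map (layout n (v(i := a))) (sem n p (v(i := a)) D))" if "a < n" for a D
    using PFor.prems that by (intro PFor.IH) (auto split: if_splits)
  from exec_For_loop[OF this, of 0 D]
  have loop: "exec (CWhile [(?x, 1)] (CSeq (compile p) (CMove ?x Rgt))) (layout n v D)
      (Suc (n * (time n p + 3))) (map (layout n (v(i := n))) (sem n (PFor i p) v D))"
    by (simp add: v)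
  have "exec (rewind ?x) s' (2 * n + 5) [layout n v (data_tapes s')]"
    if s'_in: "s' \<in> set (map (layout n (v(i := n))) (sem n (PFor i p) v D))" for s'
  proof -
    obtain D' where s': "s' = layout n (v(i := n)) D'" using s'_in by auto
    then have "exec (rewind ?x) s' (2 * n + 5) [s'(?x := (int 0, marks n))]"
      using exec_rewind[of s' ?x n] by simp
    then show ?thesis using layout_var[of n "v(i := n)" D' i 0] by (simp add: s' v)
  qed
  from exec_Seq[OF loop this]
  have "exec (compile (PFor i p)) (layout n v D) (Suc (Suc (n * (time n p + 3)) + (2 * n + 5)))
      (map (layout n v) (sem n (PFor i p) v D))"
    by (simp add: o_def concat_map_singleton)
  then show ?case by (rule exec_mono) (simp add: algebra_simps)
qed

lemma ex_cmd_wf_compile: "prog_wf p \<Longrightarrow> \<exists>k. cmd_wf k (compile p)"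
proof -
  \<comment> \<open>The sum of the bounds of the parts dominates each of them;
    \<open>2 * i + 4\<close> exceeds the tape \<open>2 * i + 3\<close> of a variable and the counter
    tape 1.\<close>
  define B where "B = rec_prog (\<lambda>j m. 2 * j + 3) (\<lambda>j ws. 2 * j + 3) (\<lambda>p q a b. a + b)
    (\<lambda>j a p q x y. 2 * j + x + y + 3) (\<lambda>i i' p q a b. 2 * i + 2 * i' + 4 + a + b)
    (\<lambda>i i' p q a b. 2 * i + 2 * i' + 4 + a + b) (\<lambda>i p a. 2 * i + 4 + a)"
  have "cmd_wf (B p) (compile p)" if "prog_wf p"
    using that
    by (induction p)
      (auto simp: B_def compare_def restore_def rewind_def intro: cmd_wf_mono)
  then show "prog_wf p \<Longrightarrow> \<exists>k. cmd_wf k (compile p)" by blast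
qed

lemma time_poly: "\<exists>P :: nat poly. \<forall>n. time n p \<le> poly P n"
proof (induction p)
  case (PMove j m)
  show ?case by (rule exI[of _ "[:1:]"]) simp
next
  case (PWrite j ws)
  show ?case by (rule exI[of _ "[:1:]"]) simp
next
  case (PSeq p q)
  then obtain P Q :: "nat poly" where "\<forall>n. time n p \<le> poly P n" "\<forall>n. time n q \<le> poly Q n" by blast
  then show ?case by (intro exI[of _ "P + Q + [:1:]"]) (simp add: add_mono)
next
  case (PIf j a p q)
  then obtain P Q :: "nat poly" where "\<forall>n. time n p \<le> poly P n" "\<forall>n. time n q \<le> poly Q n" by blast
  then show ?case by (intro exI[of _ "P + Q + [:1:]"]) (simp add: add_mono)
next
  case (PEq i i' p q)
  then obtain P Q :: "nat poly" where "\<forall>n. time n p \<le> poly P n" "\<forall>n. time n q \<le> poly Q n" by blast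
  then show ?case by (intro exI[of _ "P + Q + [:6, 12:]"]) (simp add: add_mono)
next
  case (PLe i i' p q)
  then obtain P Q :: "nat poly" where "\<forall>n. time n p \<le> poly P n" "\<forall>n. time n q \<le> poly Q n" by blast
  then show ?case by (intro exI[of _ "P + Q + [:6, 12:]"]) (simp add: add_mono)
next
  case (PFor i p)
  then obtain P :: "nat poly" where "\<forall>n. time n p \<le> poly P n" by blast
  then show ?case by (intro exI[of _ "[:0, 1:] * (P + [:5:]) + [:10:]"]) simp
qed

lemma poly_nat_mono: "m \<le> n \<Longrightarrow> poly P m \<le> poly P (n :: nat)"
  by (induction P) (auto intro: add_mono mult_mono)

section \<open>Iteration over tuples\<close>

abbreviation all_tuples :: "nat \<Rightarrow> nat \<Rightarrow> nat list list" where
  "all_tuples n r \<equiv> product_lists (replicate r [0..<n])"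

definition skip :: prog where
  "skip = PMove 0 Stay"

definition PFors :: "nat list \<Rightarrow> prog \<Rightarrow> prog" where
  "PFors is p = foldr PFor is p"

definition PEqs :: "(nat \<times> nat) list \<Rightarrow> prog \<Rightarrow> prog" where
  "PEqs ps p = foldr (\<lambda>(i, i') q. PEq i i' q skip) ps p"

primrec upds :: "(nat \<Rightarrow> nat) \<Rightarrow> nat list \<Rightarrow> nat list \<Rightarrow> nat \<Rightarrow> nat" where
  "upds v [] t = v"
| "upds v (i # is) t = upds (v(i := hd t)) is (tl t)"

text \<open>Runs \<open>p\<close> with the head of data tape \<open>j\<close> moved to the cell whose distance is the position, in
  the lexicographic order, of the tuple of the values of the variables \<open>xs\<close>. The variables from
  \<open>d\<close> on have to be unused.\<close>

definition access :: "nat \<Rightarrow> nat \<Rightarrow> nat list \<Rightarrow> prog \<Rightarrow> prog" where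
  "access d j xs p = (let is = [d..<d + length xs] in
     PSeq (PFors is (PSeq (PEqs (zip is xs) p) (PMove j Rgt))) (PFors is (PMove j Lft)))"

text \<open>Steps over whole tables: \<open>r\<close> nested loops make \<open>n ^ r\<close> moves,
  the length of the table of a relation of arity \<open>r\<close>.\<close>

definition shift :: "nat \<Rightarrow> nat list \<Rightarrow> nat \<Rightarrow> move \<Rightarrow> prog" where
  "shift d rs j m = foldr (\<lambda>r. PSeq (PFors [d..<d + r] (PMove j m))) rs skip"

section \<open>Nested loops as iteration over tuples\<close>

lemma iter_append: "iter f (as @ bs) D = concat (map (iter f bs) (iter f as D))"
proof (induction as arbitrary: D)
  case (Cons a as)
  have "concat (map (\<lambda>D. concat (map (iter f bs) (iter f as D))) Ds) =
      concat (map (iter f bs) (concat (map (iter f as) Ds)))" for Ds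
    by (induction Ds) auto
  moreover have "iter f (as @ bs) = (\<lambda>D. concat (map (iter f bs) (iter f as D)))"
    using Cons by blast
  ultimately show ?case by simp
qed simp

lemma iter_map: "iter f (map g as) D = iter (\<lambda>a. f (g a)) as D"
  by (induction as arbitrary: D) (auto intro!: arg_cong[where f = concat] map_cong)

lemma iter_concat_map:
  "iter f (concat (map g as)) D = iter (\<lambda>a. iter f (g a)) as D"
proof (induction as arbitrary: D)
  case (Cons a as)
  then have "iter f (concat (map g as)) = iter (\<lambda>a. iter f (g a)) as" by blast
  then show ?case by (simp add: iter_append)
qed simp

lemma iter_cong: "(\<And>a D. a \<in> set as \<Longrightarrow> f a D = g a D) \<Longrightarrow> iter f as D = iter g as D"
  by (induction as arbitrary: D) (auto intro!: arg_cong[where f = concat])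

lemma iter_move:
  assumes "\<And>a D. a \<in> set as \<Longrightarrow> f a D = [D(j := (fst (D j) + c, snd (D j)))]"
  shows "iter f as D = [D(j := (fst (D j) + c * int (length as), snd (D j)))]"
  using assms
proof (induction as arbitrary: D)
  case (Cons a as)
  let ?D = "D(j := (fst (D j) + c, snd (D j)))"
  have "f a D = [?D]" by (rule Cons.prems) simp
  then have "iter f (a # as) D = iter f as ?D" by simp
  also have "\<dots> = [?D(j := (fst (?D j) + c * int (length as), snd (?D j)))]"
    by (rule Cons.IH) (use Cons.prems in auto)
  also have "\<dots> = [D(j := (fst (D j) + c * int (length (a # as)), snd (D j)))]"
    by (simp add: distrib_left add.assoc)
  finally show ?case .
qed simp

lemma sem_skip [simp]: "sem n skip v D = [D]"
  by (simp add: skip_def)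

lemma concat_map_iter_Nil [simp]: "concat (map (iter f []) Ds) = Ds"
  by (induction Ds) auto

text \<open>Nested loops vary the innermost variable fastest, and \<open>product_lists\<close> lists
  the tuples in just this order.\<close>

lemma sem_PFors:
  "sem n (PFors is p) v D = iter (\<lambda>t. sem n p (upds v is t)) (all_tuples n (length is)) D"
proof (induction "is" arbitrary: v D)
  case (Cons i "is")
  have "sem n (PFors (i # is) p) v D = iter (\<lambda>a. sem n (PFors is p) (v(i := a))) [0..<n] D"
    by (simp add: PFors_def)
  also have "\<dots> = iter (\<lambda>a. iter (\<lambda>t. sem n p (upds v (i # is) t))
      (map ((#) a) (all_tuples n (length is)))) [0..<n] D"
    by (rule iter_cong) (simp add: Cons.IH iter_map del: fun_upd_apply)
  finally show ?case by (simp add: iter_concat_map)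
qed (simp add: PFors_def)

lemma sem_PEqs:
  "sem n (PEqs ps p) v D = (if \<forall>(i, i') \<in> set ps. v i = v i' then sem n p v D else [D])"
  by (induction ps) (auto simp: PEqs_def)

lemma upds_notin: "j \<notin> set is \<Longrightarrow> upds v is t j = v j"
  by (induction "is" arbitrary: v t) auto

lemma map_upds: "distinct is \<Longrightarrow> length t = length is \<Longrightarrow> map (upds v is t) is = t"
proof (induction "is" arbitrary: v t)
  case (Cons i "is")
  then show ?case by (cases t) (auto simp: upds_notin)
qed simp

lemma length_all_tuples: "length (all_tuples n r) = n ^ r"
  by (induction r) (simp_all add: length_concat o_def sum_list_triv)

lemma distinct_all_tuples: "distinct (all_tuples n r)"
  by (intro distinct_product_lists) auto

lemma length_in_all_tuples: "t \<in> set (all_tuples n r) \<Longrightarrow> length t = r"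
  by (simp add: set_product_lists_upt tuples_def)

lemma loop_vars_PFors [simp]: "loop_vars (PFors is p) = set is \<union> loop_vars p"
  by (induction "is") (auto simp: PFors_def)

lemma prog_wf_PFors [simp]:
  "prog_wf (PFors is p) \<longleftrightarrow> prog_wf p \<and> distinct is \<and> set is \<inter> loop_vars p = {}"
  by (induction "is") (use loop_vars_PFors in \<open>auto simp: PFors_def\<close>)

lemma loop_vars_PEqs [simp]: "loop_vars (PEqs ps p) = loop_vars p"
  by (induction ps) (simp_all add: PEqs_def skip_def split_def)

lemma prog_wf_PEqs [simp]: "prog_wf (PEqs ps p) = prog_wf p"
  by (induction ps) (simp_all add: PEqs_def skip_def split_def)

lemma loop_vars_access: "loop_vars (access d j xs p) = {d..<d + length xs} \<union> loop_vars p"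
  by (auto simp: access_def Let_def)

lemma prog_wf_access: "prog_wf p \<Longrightarrow> loop_vars p = {} \<Longrightarrow> prog_wf (access d j xs p)"
  by (auto simp: access_def Let_def)

lemma loop_vars_shift: "loop_vars (shift d rs j m) \<subseteq> {d..}"
  by (induction rs) (auto simp: shift_def skip_def)

lemma prog_wf_shift: "prog_wf (shift d rs j m)"
  by (induction rs) (auto simp: shift_def skip_def)

lemma sem_move_tuples:
  "sem n (PFors is (PMove j m)) v D =
    [D(j := (fst (D j) + offset m * int (n ^ length is), snd (D j)))]"
  unfolding sem_PFors
  by (subst iter_move[where j = j and c = "offset m"]) (simp_all add: length_all_tuples)

lemma sem_shift:
  "sem n (shift d rs j m) v D =
    [D(j := (fst (D j) + offset m * int (\<Sum>r\<leftarrow>rs. n ^ r), snd (D j)))]"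
  by (induction rs arbitrary: D) (simp_all add: shift_def sem_move_tuples algebra_simps)

text \<open>Each tuple is listed once, so the test succeeds in round \<open>K\<close> only; every
  other round is a plain move, and the final loops take all \<open>n ^ r\<close> moves back. The
  premise on \<open>p\<close> ranges over all \<open>v'\<close> because \<open>p\<close> runs with
  the scanning variables changed.\<close>

lemma sem_access:
  assumes "\<forall>x \<in> set xs. x < d" "D j = (h, g)"
    "K < length (all_tuples n (length xs))" "all_tuples n (length xs) ! K = map v xs"
    and p: "\<And>v'. sem n p v' (D(j := (h + int K, g))) = [D'(j := (h + int K, g'))]"
  shows "sem n (access d j xs p) v D = [D'(j := (h, g'))]"
proof -
  define r where "r = length xs"
  define L where "L = all_tuples n r"
  define us where "us = [d..<d + r]"
  let ?f = "\<lambda>t. sem n (PSeq (PEqs (zip us xs) p) (PMove j Rgt)) (upds v us t)"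
  have us: "distinct us" "length us = r" "set us \<inter> set xs = {}"
    using assms(1) by (auto simp: us_def)
  \<comment> \<open>The scanning variables lie outside \<open>xs\<close>: they hold
    \<open>t\<close>, while the variables in \<open>xs\<close> keep their values.\<close>
  have test: "(\<forall>(i, i') \<in> set (zip us xs). upds v us t i = upds v us t i') \<longleftrightarrow> t = map v xs"
    if "t \<in> set L" for t
  proof -
    have "length t = r" using that length_in_all_tuples by (simp add: L_def)
    then have "map (upds v us t) us = t" using us by (simp add: map_upds)
    moreover have "map (upds v us t) xs = map v xs"
      using us(3) by (intro map_cong refl upds_notin) blast
    moreover have "(\<forall>(i, i') \<in> set (zip us xs). upds v us t i = upds v us t i') \<longleftrightarrow>
        map (upds v us t) us = map (upds v us t) xs"
      using us(2) by (auto simp: list_eq_iff_nth_eq set_zip r_def)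
    ultimately show ?thesis by (simp only:)
  qed
  have K: "K < length L" "L ! K = map v xs" using assms(3,4) by (simp_all add: L_def r_def)
  have L: "L = take K L @ map v xs # drop (Suc K) L" using K by (metis id_take_nth_drop)
  have dist: "distinct (take K L @ map v xs # drop (Suc K) L)"
    by (subst L[symmetric]) (simp add: L_def distinct_all_tuples)
  have other: "t \<noteq> map v xs" if "t \<in> set (take K L) \<union> set (drop (Suc K) L)" for t
    using that dist by auto
  have move: "?f t E = [E(j := (fst (E j) + 1, snd (E j)))]"
    if "t \<in> set (take K L) \<union> set (drop (Suc K) L)" for t E
    using other[OF that] that test[of t] by (auto simp: sem_PEqs dest: in_set_takeD in_set_dropD)
  have 1: "iter ?f (take K L) D = [D(j := (h + int K, g))]"
    using iter_move[of "take K L" ?f j 1 D] move K(1) assms(2) by simp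
  have 2: "?f (map v xs) (D(j := (h + int K, g))) = [D'(j := (h + int K + 1, g'))]"
    using test[of "map v xs"] K by (simp add: sem_PEqs p nth_mem[of K L, simplified K])
  have 3: "iter ?f (drop (Suc K) L) (D'(j := (h + int K + 1, g'))) =
      [D'(j := (h + int (length L), g'))]"
    using iter_move[of "drop (Suc K) L" ?f j 1 "D'(j := (h + int K + 1, g'))"] move K(1)
    by (simp add: of_nat_diff)
  have "iter ?f (take K L @ map v xs # drop (Suc K) L) D = [D'(j := (h + int (length L), g'))]"
    by (simp only: iter_append 1 list.map concat.simps iter.simps 2 append_Nil2 3)
  then have "iter ?f L D = [D'(j := (h + int (length L), g'))]"
    by (simp only: L[symmetric])
  then show ?thesis
    using us(2) by (simp add: access_def Let_def sem_PFors[of n us "PSeq _ _"] sem_move_tuples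
        L_def length_all_tuples flip: us_def r_def)
qed

section \<open>Evaluation of formulas\<close>

primrec formula_wf :: "vocabulary \<Rightarrow> nat \<Rightarrow> formula \<Rightarrow> bool" where
  "formula_wf \<sigma> m (Rel i xs) \<longleftrightarrow> i < length \<sigma> \<and> length xs = \<sigma> ! i"
| "formula_wf \<sigma> m (Eq x y) \<longleftrightarrow> True"
| "formula_wf \<sigma> m (Le x y) \<longleftrightarrow> True"
| "formula_wf \<sigma> m (SOVar xs) \<longleftrightarrow> length xs = m"
| "formula_wf \<sigma> m (Neg \<phi>) \<longleftrightarrow> formula_wf \<sigma> m \<phi>"
| "formula_wf \<sigma> m (Conj \<phi> \<psi>) \<longleftrightarrow> formula_wf \<sigma> m \<phi> \<and> formula_wf \<sigma> m \<psi>"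
| "formula_wf \<sigma> m (Exists x \<phi>) \<longleftrightarrow> formula_wf \<sigma> m \<phi>"

text \<open>Data tape 0 holds the input, with the head behind the first 1. Data tape 1 holds the
  characteristic string of the complement of \<open>X\<close>, so that the initial blank tape represents the
  full relation. The truth value is left on data tape 2. The renaming \<open>\<rho>\<close> of the variables of the
  formula avoids that a quantifier overwrites the value of a variable in an outer scope.\<close>

definition bit_tape :: "bool \<Rightarrow> tape" where
  "bit_tape b = (0, \<lambda>z. if z = 0 then of_bool b else 0)"

definition complement_tape :: "nat \<Rightarrow> nat \<Rightarrow> nat list set \<Rightarrow> tape" where
  "complement_tape n m X = (0, \<lambda>z. of_bool (0 \<le> z \<and> nat z < n ^ m \<and> all_tuples n m ! nat z \<notin> X))"

definition set_flag :: "bool \<Rightarrow> prog" where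
  "set_flag b = PWrite 2 [of_bool b]"

text \<open>The flag is expected to be False on entry, so atoms only have to set it, and a
  quantifier skips its body once a witness is found. A relation is tested for 2, the symbol of a
  true bit, but \<open>X\<close> for 0, since its complement is stored. The variables from
  \<open>d\<close> on are free for new loops.\<close>

primrec eval_formula :: "vocabulary \<Rightarrow> (nat \<Rightarrow> nat) \<Rightarrow> nat \<Rightarrow> formula \<Rightarrow> prog" where
  "eval_formula \<sigma> \<rho> d (Rel i xs) = PSeq (shift d (take i \<sigma>) 0 Rgt)
     (PSeq (access d 0 (map \<rho> xs) (PIf 0 2 (set_flag True) skip)) (shift d (take i \<sigma>) 0 Lft))"
| "eval_formula \<sigma> \<rho> d (Eq x y) = PEq (\<rho> x) (\<rho> y) (set_flag True) skip"
| "eval_formula \<sigma> \<rho> d (Le x y) = PLe (\<rho> x) (\<rho> y) (set_flag True) skip"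
| "eval_formula \<sigma> \<rho> d (SOVar xs) = access d 1 (map \<rho> xs) (PIf 1 0 (set_flag True) skip)"
| "eval_formula \<sigma> \<rho> d (Neg \<phi>) =
     PSeq (eval_formula \<sigma> \<rho> d \<phi>) (PIf 2 1 (set_flag False) (set_flag True))"
| "eval_formula \<sigma> \<rho> d (Conj \<phi> \<psi>) =
     PSeq (eval_formula \<sigma> \<rho> d \<phi>) (PIf 2 1 (PSeq (set_flag False) (eval_formula \<sigma> \<rho> d \<psi>)) skip)"
| "eval_formula \<sigma> \<rho> d (Exists x \<phi>) =
     PFor d (PIf 2 1 skip (eval_formula \<sigma> (\<rho>(x := d)) (Suc d) \<phi>))"

lemma loop_vars_eval_formula: "loop_vars (eval_formula \<sigma> \<rho> d \<phi>) \<subseteq> {d..}"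
proof (induction \<phi> arbitrary: \<rho> d)
  case (Rel i xs)
  show ?case
    using loop_vars_shift[of d "take i \<sigma>"] by (auto simp: loop_vars_access set_flag_def skip_def)
next
  case (Exists x \<phi>)
  have "{Suc d..} \<subseteq> {d..}" by auto
  moreover have "loop_vars (eval_formula \<sigma> (\<rho>(x := d)) (Suc d) \<phi>) \<subseteq> {Suc d..}"
    by (rule Exists.IH)
  ultimately show ?case by (simp add: skip_def subset_trans del: fun_upd_apply)
qed (auto simp: loop_vars_access set_flag_def skip_def subset_iff)

lemma prog_wf_eval_formula: "prog_wf (eval_formula \<sigma> \<rho> d \<phi>)"
proof (induction \<phi> arbitrary: \<rho> d)
  case (Exists x \<phi>)
  then show ?case using loop_vars_eval_formula[of \<sigma> "\<rho>(x := d)" "Suc d" \<phi>]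
    by (auto simp: skip_def)
qed (auto simp: set_flag_def skip_def prog_wf_shift intro!: prog_wf_access)

lemma bit_tape_simps [simp]:
  "fst (bit_tape b) = 0" "read_tape (bit_tape b) = of_bool b"
  "(0, (snd (bit_tape b))(0 := of_bool c)) = bit_tape c"
  by (auto simp: bit_tape_def read_tape_def fun_eq_iff)

lemma bit_tape_write:
  "(0, (snd (bit_tape b))(0 := Suc 0)) = bit_tape True"
  "(0, (snd (bit_tape b))(0 := 0)) = bit_tape False"
  using bit_tape_simps(3)[of b True] bit_tape_simps(3)[of b False] by simp_all

lemma sem_set_flag: "D 2 = bit_tape b \<Longrightarrow> sem n (set_flag c) v D = [D(2 := bit_tape c)]"
  by (simp add: set_flag_def)

lemma nth_concat_offset:
  assumes "i < length xss" "k < length (xss ! i)"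
  shows "concat xss ! (length (concat (take i xss)) + k) = xss ! i ! k"
    "length (concat (take i xss)) + k < length (concat xss)"
proof -
  have eq: "concat xss = concat (take i xss) @ (xss ! i) @ concat (drop (Suc i) xss)"
    by (metis assms(1) concat.simps(2) concat_append id_take_nth_drop)
  show "concat xss ! (length (concat (take i xss)) + k) = xss ! i ! k"
    "length (concat (take i xss)) + k < length (concat xss)"
    using assms(2) by (subst eq, simp add: nth_append)+
qed

text \<open>The summands of the position stem from the leading zeros with the separating 1, from the
  tables of the earlier relations, and from the index within the table.\<close>

lemma input_tape_encode:
  assumes "A \<in> structures \<sigma>" "i < length \<sigma>" "K < univ_size A ^ (\<sigma> ! i)"
  shows "snd (input_tape (encode \<sigma> A))
      (int (univ_size A) + 1 + int (\<Sum>r\<leftarrow>take i \<sigma>. univ_size A ^ r) + int K) =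
    symbol_of_bit (all_tuples (univ_size A) (\<sigma> ! i) ! K \<in> rels A ! i)"
proof -
  let ?n = "univ_size A"
  let ?w = "\<lambda>r R. map (\<lambda>v. v \<in> R) (all_tuples ?n r)"
  let ?W = "map2 ?w \<sigma> (rels A)"
  have len: "length (rels A) = length \<sigma>" using assms(1) by (simp add: structures_def)
  have offset: "length (concat (take i ?W)) = (\<Sum>r\<leftarrow>take i \<sigma>. ?n ^ r)"
  proof -
    have "map length (take i ?W) = map (\<lambda>r. ?n ^ r) (take i \<sigma>)"
      using len by (auto simp: list_eq_iff_nth_eq length_all_tuples)
    then show ?thesis by (simp add: length_concat)
  qed
  have W: "i < length ?W" "K < length (?W ! i)"
    using assms len by (simp_all add: length_all_tuples)
  have *: "encode \<sigma> A ! (?n + 1 + (\<Sum>r\<leftarrow>take i \<sigma>. ?n ^ r) + K) = ?W ! i ! K"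
    "?n + 1 + (\<Sum>r\<leftarrow>take i \<sigma>. ?n ^ r) + K < length (encode \<sigma> A)"
    using nth_concat_offset[OF W] unfolding offset by (simp_all add: encode_def nth_append)
  have "?W ! i ! K \<longleftrightarrow> all_tuples ?n (\<sigma> ! i) ! K \<in> rels A ! i"
    using assms(2,3) len by (simp add: length_all_tuples)
  moreover have "snd (input_tape x) (int k) = symbol_of_bit (x ! k)" if "k < length x" for x k
    using that by (simp add: input_tape_def)
  from this[OF *(2)] have "snd (input_tape (encode \<sigma> A))
      (int (?n + 1 + (\<Sum>r\<leftarrow>take i \<sigma>. ?n ^ r) + K)) = symbol_of_bit (?W ! i ! K)"
    unfolding *(1) .
  ultimately show ?thesis by (simp add: ac_simps)
qed

lemma iter_flag_ex:
  assumes "\<And>a b. a \<in> set as \<Longrightarrow> f a (E(2 := bit_tape b)) = [E(2 := bit_tape (b \<or> P a))]"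
  shows "iter f as (E(2 := bit_tape b)) = [E(2 := bit_tape (b \<or> (\<exists>a \<in> set as. P a)))]"
  using assms by (induction as arbitrary: b) (auto simp: disj_assoc)

lemma ex_tuple_index:
  "set t \<subseteq> {..<n} \<Longrightarrow>
    \<exists>K < length (all_tuples n (length t)). all_tuples n (length t) ! K = t"
  using set_product_lists_upt[of "length t" n]
  by (metis (mono_tags, lifting) in_set_conv_nth mem_Collect_eq tuples_def)

lemma sem_eval_formula:
  assumes A: "A \<in> structures \<sigma>" and n: "n = univ_size A"
  shows "formula_wf \<sigma> m \<phi> \<Longrightarrow> (\<And>x. \<rho> x < d) \<Longrightarrow> (\<And>i. v i < n) \<Longrightarrow>
    D 0 = (int n + 1, snd (input_tape (encode \<sigma> A))) \<Longrightarrow> D 1 = complement_tape n m X \<Longrightarrow>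
    D 2 = bit_tape False \<Longrightarrow>
    sem n (eval_formula \<sigma> \<rho> d \<phi>) v D = [D(2 := bit_tape (sat A X (v \<circ> \<rho>) \<phi>))]"
proof (induction \<phi> arbitrary: \<rho> d v D)
  case (Rel i xs)
  let ?S = "\<Sum>r\<leftarrow>take i \<sigma>. n ^ r"
  let ?g = "snd (input_tape (encode \<sigma> A))"
  let ?b = "map (v \<circ> \<rho>) xs \<in> rels A ! i"
  let ?D = "D(0 := (int n + 1 + int ?S, ?g))"
  have "set (map (v \<circ> \<rho>) xs) \<subseteq> {..<n}" using Rel.prems(3) by auto
  then obtain K where K: "K < length (all_tuples n (length xs))"
    "all_tuples n (length xs) ! K = map (v \<circ> \<rho>) xs"
    using ex_tuple_index by (metis length_map)
  have g: "?g (int n + 1 + int ?S + int K) = symbol_of_bit ?b"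
    using input_tape_encode[OF A, of i K] Rel.prems(1) K by (simp add: n length_all_tuples)
  have "sem n (access d 0 (map \<rho> xs) (PIf 0 2 (set_flag True) skip)) v ?D =
      [(D(2 := bit_tape ?b))(0 := (int n + 1 + int ?S, ?g))]"
  proof (rule sem_access[where K = K])
    fix v'
    show "sem n (PIf 0 2 (set_flag True) skip) v' (?D(0 := (int n + 1 + int ?S + int K, ?g))) =
        [(D(2 := bit_tape ?b))(0 := (int n + 1 + int ?S + int K, ?g))]"
      using Rel.prems(6) g
      by (auto simp: reads_def read_tape_def symbol_of_bit_def sem_set_flag[where b = False]
          fun_upd_twist fun_upd_idem)
  qed (use Rel.prems K in \<open>auto simp: comp_def\<close>)
  then have "sem n (eval_formula \<sigma> \<rho> d (Rel i xs)) v D = [D(2 := bit_tape ?b)]"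
    using Rel.prems(4) by (simp add: sem_shift fun_upd_twist fun_upd_idem)
  then show ?case by (simp only: sat.simps)
next
  case (Eq x y)
  then show ?case by (auto simp: sem_set_flag fun_upd_idem)
next
  case (Le x y)
  then show ?case by (auto simp: sem_set_flag fun_upd_idem)
next
  case (SOVar xs)
  let ?g = "snd (complement_tape n m X)"
  let ?b = "map (v \<circ> \<rho>) xs \<in> X"
  have "set (map (v \<circ> \<rho>) xs) \<subseteq> {..<n}" using SOVar.prems(3) by auto
  then obtain K where K: "K < length (all_tuples n (length xs))"
    "all_tuples n (length xs) ! K = map (v \<circ> \<rho>) xs"
    using ex_tuple_index by (metis length_map)
  have g: "?g (int K) = of_bool (\<not> ?b)"
    using K SOVar.prems(1) by (simp add: complement_tape_def length_all_tuples)
  have "sem n (access d 1 (map \<rho> xs) (PIf 1 0 (set_flag True) skip)) v D =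
      [(D(2 := bit_tape ?b))(1 := (0, ?g))]"
  proof (rule sem_access[where K = K])
    fix v'
    show "sem n (PIf 1 0 (set_flag True) skip) v' (D(1 := (0 + int K, ?g))) =
        [(D(2 := bit_tape ?b))(1 := (0 + int K, ?g))]"
      using SOVar.prems(6) g
      by (auto simp: reads_def read_tape_def sem_set_flag[where b = False]
          fun_upd_twist fun_upd_idem)
  qed (use SOVar.prems K in \<open>auto simp: comp_def complement_tape_def\<close>)
  then have "sem n (eval_formula \<sigma> \<rho> d (SOVar xs)) v D = [D(2 := bit_tape ?b)]"
    using SOVar.prems(5) by (simp add: fun_upd_idem complement_tape_def)
  then show ?case by (simp only: sat.simps)
next
  case (Neg \<phi>)
  have "sem n (eval_formula \<sigma> \<rho> d \<phi>) v D = [D(2 := bit_tape (sat A X (v \<circ> \<rho>) \<phi>))]"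
    by (rule Neg.IH) (use Neg.prems in simp_all)
  then have "sem n (eval_formula \<sigma> \<rho> d (Neg \<phi>)) v D =
      [D(2 := bit_tape (\<not> sat A X (v \<circ> \<rho>) \<phi>))]"
    by (simp add: reads_def sem_set_flag)
  then show ?case by (simp only: sat.simps)
next
  case (Conj \<phi> \<psi>)
  have "sem n (eval_formula \<sigma> \<rho> d \<phi>) v D = [D(2 := bit_tape (sat A X (v \<circ> \<rho>) \<phi>))]"
    by (rule Conj.IH) (use Conj.prems in simp_all)
  moreover have "sem n (eval_formula \<sigma> \<rho> d \<psi>) v (D(2 := bit_tape False)) =
      [(D(2 := bit_tape False))(2 := bit_tape (sat A X (v \<circ> \<rho>) \<psi>))]"
    by (rule Conj.IH) (use Conj.prems in simp_all)
  ultimately have "sem n (eval_formula \<sigma> \<rho> d (Conj \<phi> \<psi>)) v D =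
      [D(2 := bit_tape (sat A X (v \<circ> \<rho>) \<phi> \<and> sat A X (v \<circ> \<rho>) \<psi>))]"
    by (simp add: reads_def sem_set_flag)
  then show ?case by (simp only: sat.simps)
next
  case (Exists x \<phi>)
  let ?\<rho> = "\<rho>(x := d)"
  let ?P = "\<lambda>a. sat A X ((v \<circ> \<rho>)(x := a)) \<phi>"
  \<comment> \<open>\<open>\<rho>\<close> takes only values below \<open>d\<close>, so the new loop
    variable \<open>d\<close> affects \<open>x\<close> alone.\<close>
  have upd: "v(d := a) \<circ> ?\<rho> = (v \<circ> \<rho>)(x := a)" for a
    using Exists.prems(2) by (auto simp: fun_eq_iff less_imp_neq)
  have body: "sem n (eval_formula \<sigma> ?\<rho> (Suc d) \<phi>) (v(d := a)) (D(2 := bit_tape False)) =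
      [(D(2 := bit_tape False))(2 := bit_tape (?P a))]" if "a < n" for a
    unfolding upd[symmetric]
    by (rule Exists.IH) (use Exists.prems that in \<open>auto intro: less_SucI\<close>)
  have "iter (\<lambda>a. sem n (PIf 2 1 skip (eval_formula \<sigma> ?\<rho> (Suc d) \<phi>)) (v(d := a))) [0..<n]
      (D(2 := bit_tape False)) = [D(2 := bit_tape (False \<or> (\<exists>a \<in> set [0..<n]. ?P a)))]"
  proof (rule iter_flag_ex)
    fix a b
    assume "a \<in> set [0..<n]"
    then show "sem n (PIf 2 1 skip (eval_formula \<sigma> ?\<rho> (Suc d) \<phi>)) (v(d := a)) (D(2 := bit_tape b)) =
        [D(2 := bit_tape (b \<or> ?P a))]"
      using body[of a] by (cases b) (simp_all add: reads_def)
  qed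
  moreover have "D(2 := bit_tape False) = D" using Exists.prems(6) by (simp add: fun_upd_idem)
  ultimately have "sem n (eval_formula \<sigma> \<rho> d (Exists x \<phi>)) v D =
      [D(2 := bit_tape (\<exists>a < n. ?P a))]"
    by (simp add: Bex_def)
  then show ?case by (simp only: sat.simps n)
qed

section \<open>Counting\<close>

definition is_code_length :: "vocabulary \<Rightarrow> nat \<Rightarrow> nat \<Rightarrow> bool" where
  "is_code_length \<sigma> n l \<longleftrightarrow> l = n + 1 + (\<Sum>r\<leftarrow>\<sigma>. n ^ r)"

text \<open>Started with the head behind the leading zeros of the input, \<open>check_input\<close> tests that the
  input has the length of the encoding of a structure.\<close>

definition check_input :: "vocabulary \<Rightarrow> prog \<Rightarrow> prog" where
  "check_input \<sigma> p = PIf 0 2 (PSeq (PMove 0 Rgt) (PSeq (shift 1 \<sigma> 0 Rgt)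
     (PIf 0 0 (PSeq (PMove 0 Lft) (PIf 0 0 skip
       (PSeq (PMove 0 Rgt) (PSeq (shift 1 \<sigma> 0 Lft) p)))) skip))) skip"

text \<open>The tuple, held in the variables 1 to \<open>m\<close>, is removed tentatively by a 1 on
  the complement tape. A flag set after the second write puts it back: this is forced if the result
  is no model, and one of two branches otherwise.\<close>

definition choose_tuple :: "nat \<Rightarrow> prog \<Rightarrow> prog" where
  "choose_tuple m c = PSeq (access (Suc m) 1 [1..<Suc m] (PWrite 1 [1])) (PSeq c
     (PSeq (PIf 2 1 (PWrite 2 [0, 1]) (PWrite 2 [1]))
       (PIf 2 1 (PSeq (access (Suc m) 1 [1..<Suc m] (PWrite 1 [0])) (set_flag False)) skip)))"

text \<open>The first write of \<open>[0, 1]\<close> splits off the additional path, which stops at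
  once on 0. Variable 0 is bound by no loop and keeps the value 0, so renaming all variables to it
  yields the assignment \<open>\<lambda>_. 0\<close> of \<open>count_SO\<close>.\<close>

definition count_models :: "vocabulary \<Rightarrow> nat \<Rightarrow> formula \<Rightarrow> prog" where
  "count_models \<sigma> m \<psi> = (let c = eval_formula \<sigma> (\<lambda>_. 0) (Suc m) \<psi> in
     PSeq c (PIf 2 1 (PSeq (PWrite 2 [0, 1])
       (PIf 2 1 (PSeq (set_flag False) (PFors [1..<Suc m] (choose_tuple m c))) skip)) skip))"

section \<open>Executions and models\<close>

lemma read_input_tape:
  "read_tape (z, snd (input_tape x)) =
    (if 0 \<le> z \<and> z < int (length x) then symbol_of_bit (x ! nat z) else blank)"
  by (simp add: read_tape_def input_tape_def)

text \<open>The input contains no blanks, so a blank at cell \<open>n + 1 + ?S\<close> and a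
  nonblank on its left determine the length. Failure leaves exactly one execution, which stands for
  the value 0.\<close>

lemma sem_check_input:
  assumes D: "D 0 = (int n, snd (input_tape x))"
  shows "n < length x \<and> x ! n \<and> is_code_length \<sigma> n (length x) \<Longrightarrow>
      sem n (check_input \<sigma> p) v D = sem n p v (D(0 := (int n + 1, snd (input_tape x))))"
    and "\<not> (n < length x \<and> x ! n \<and> is_code_length \<sigma> n (length x)) \<Longrightarrow>
      length (sem n (check_input \<sigma> p) v D) = 1"
proof -
  let ?S = "\<Sum>r\<leftarrow>\<sigma>. n ^ r"
  let ?g = "snd (input_tape x)"
  have 0: "reads D 0 = 2 \<longleftrightarrow> n < length x \<and> x ! n"
    using D by (simp add: reads_def read_input_tape symbol_of_bit_def blank_def)
  have 1: "read_tape (int n + 1 + int ?S, ?g) = 0 \<longleftrightarrow> length x \<le> n + 1 + ?S"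
    by (auto simp: read_input_tape symbol_of_bit_def blank_def)
  have 2: "read_tape (int n + 1 + int ?S - 1, ?g) = 0 \<longleftrightarrow> length x \<le> n + ?S"
    by (auto simp: read_input_tape symbol_of_bit_def blank_def)
  show "sem n (check_input \<sigma> p) v D = sem n p v (D(0 := (int n + 1, ?g)))"
    if "n < length x \<and> x ! n \<and> is_code_length \<sigma> n (length x)"
    using that 0 1 2 D
    by (simp add: check_input_def sem_shift reads_def is_code_length_def)
  show "length (sem n (check_input \<sigma> p) v D) = 1"
    if "\<not> (n < length x \<and> x ! n \<and> is_code_length \<sigma> n (length x))"
    using that 0 1 2 D
    by (auto simp: check_input_def sem_shift reads_def is_code_length_def)
qed

lemma sem_write_tuple:
  assumes t: "t \<in> set (all_tuples n m)" "map v [1..<Suc m] = t"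
  shows "sem n (access (Suc m) 1 [1..<Suc m] (PWrite 1 [of_bool b])) v
      (D(1 := complement_tape n m X)) =
    [D(1 := complement_tape n m (if b then X - {t} else insert t X))]"
proof -
  obtain K where K: "K < length (all_tuples n m)" "all_tuples n m ! K = t"
    using t(1) by (meson in_set_conv_nth)
  let ?g = "snd (complement_tape n m X)"
  \<comment> \<open>Each tuple occurs once in the enumeration, so changing one cell changes the
    membership of \<open>t\<close> only.\<close>
  have inj: "all_tuples n m ! k = t \<longleftrightarrow> k = K" if "k < n ^ m" for k
    using K that distinct_all_tuples[where n = n and r = m]
    by (simp add: length_all_tuples nth_eq_iff_index_eq flip: K(2))
  have g: "(?g(int K := of_bool b)) z =
      snd (complement_tape n m (if b then X - {t} else insert t X)) z" for z
  proof (cases "z = int K")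
    case True
    then show ?thesis using K by (simp add: complement_tape_def length_all_tuples)
  next
    case False
    then have "nat z \<noteq> K" if "0 \<le> z" using that by auto
    then show ?thesis using False inj[of "nat z"] by (auto simp: complement_tape_def)
  qed
  have "sem n (access (Suc m) 1 [1..<Suc m] (PWrite 1 [of_bool b])) v
      (D(1 := complement_tape n m X)) =
    [(D(1 := complement_tape n m X))(1 := (0, ?g(int K := of_bool b)))]"
  proof (rule sem_access[where K = K])
    show "(D(1 := complement_tape n m X)) 1 = (0, ?g)" by (simp add: complement_tape_def)
    show "K < length (all_tuples n (length [1..<Suc m]))" using K by (simp del: upt_Suc)
    show "all_tuples n (length [1..<Suc m]) ! K = map v [1..<Suc m]" using K t(2) by (simp del: upt_Suc)
  qed auto
  moreover have "(0, ?g(int K := of_bool b)) =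
      complement_tape n m (if b then X - {t} else insert t X)"
    using g by (auto simp: complement_tape_def fun_eq_iff)
  ultimately show ?thesis by simp
qed

lemma sem_choose_tuple:
  assumes t: "t \<in> set (all_tuples n m)" "map v [1..<Suc m] = t" and X: "t \<in> X"
    and D: "D 2 = bit_tape False"
    and c: "sem n c v (D(1 := complement_tape n m (X - {t}))) =
      [D(1 := complement_tape n m (X - {t}), 2 := bit_tape P)]"
  shows "sem n (choose_tuple m c) v (D(1 := complement_tape n m X)) =
    (if P then [D(1 := complement_tape n m (X - {t})), D(1 := complement_tape n m X)]
     else [D(1 := complement_tape n m X)])"
proof -
  let ?T = "complement_tape n m"
  have out: "sem n (access (Suc m) 1 [1..<Suc m] (PWrite 1 [1])) v (D(1 := ?T X)) =
      [D(1 := ?T (X - {t}))]"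
    using sem_write_tuple[OF t, of True] by simp
  have "sem n (access (Suc m) 1 [1..<Suc m] (PWrite 1 [0])) v
      ((D(2 := bit_tape True))(1 := ?T (X - {t}))) = [(D(2 := bit_tape True))(1 := ?T X)]"
    using sem_write_tuple[OF t, of False "D(2 := bit_tape True)" "X - {t}"] X
    by (simp add: insert_absorb)
  then have restored: "sem n (access (Suc m) 1 [1..<Suc m] (PWrite 1 [0])) v
      (D(1 := ?T (X - {t}), 2 := bit_tape True)) = [D(1 := ?T X, 2 := bit_tape True)]"
    by (simp add: fun_upd_twist)
  have D': "D(1 := a, 2 := bit_tape False) = D(1 := a)" for a
    using D by (simp add: fun_upd_idem)
  show ?thesis
    unfolding choose_tuple_def sem.simps(3) out
    using c restored D'
    by (cases P) (simp_all add: D reads_def bit_tape_write sem_set_flag del: upt_Suc)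
qed

text \<open>The sets \<open>Y\<close> split according to whether they contain \<open>t\<close>.
  Those without \<open>t\<close> are subsets of \<open>X - {t}\<close>; if this set fails
  \<open>P\<close>, so do they by monotonicity, and refusing the branch loses nothing.
  \<open>P X\<close> is an invariant, so that at the end exactly one set, \<open>X\<close> itself,
  is counted.\<close>

lemma card_choices:
  assumes "finite X" "distinct ts" "set ts \<subseteq> X" "P X"
    and mono: "\<And>Y Z. P Y \<Longrightarrow> Y \<subseteq> Z \<Longrightarrow> P Z"
    and f: "\<And>t Y. t \<in> set ts \<Longrightarrow> t \<in> Y \<Longrightarrow>
      f t (S Y) = (if P (Y - {t}) then [S (Y - {t}), S Y] else [S Y])"
  shows "length (iter f ts (S X)) = card {Y. X - set ts \<subseteq> Y \<and> Y \<subseteq> X \<and> P Y}"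
  using assms(1-4) f
proof (induction ts arbitrary: X)
  case Nil
  then have "{Y. X - set [] \<subseteq> Y \<and> Y \<subseteq> X \<and> P Y} = {X}" by auto
  then show ?case by simp
next
  case (Cons t ts)
  let ?C = "\<lambda>X. {Y. X - set ts \<subseteq> Y \<and> Y \<subseteq> X \<and> P Y}"
  have t: "t \<in> X" "t \<notin> set ts" "distinct ts" "set ts \<subseteq> X" "set ts \<subseteq> X - {t}"
    using Cons.prems by auto
  have fin: "finite (?C Y)" if "Y \<subseteq> X" for Y
    using that Cons.prems(1) by (auto intro: finite_subset[of _ "Pow X"])
  have decomp: "{Y. X - set (t # ts) \<subseteq> Y \<and> Y \<subseteq> X \<and> P Y} = ?C X \<union> ?C (X - {t})"
    using t by auto
  have disj: "?C X \<inter> ?C (X - {t}) = {}" using t by auto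
  have IH1: "length (iter f ts (S X)) = card (?C X)"
    using Cons.prems t by (intro Cons.IH) auto
  have IH2: "length (iter f ts (S (X - {t}))) = card (?C (X - {t}))" if "P (X - {t})"
    using Cons.prems t that by (intro Cons.IH) auto
  have "f t (S X) = (if P (X - {t}) then [S (X - {t}), S X] else [S X])"
    using t(1) by (intro Cons.prems(5)) auto
  moreover have "card (?C (X - {t})) = 0" if "\<not> P (X - {t})"
  proof -
    have "?C (X - {t}) = {}" using that mono by blast
    then show ?thesis by (simp only: card.empty)
  qed
  ultimately have "length (iter f (t # ts) (S X)) = card (?C X) + card (?C (X - {t}))"
    using IH1 IH2 by (cases "P (X - {t})") simp_all
  also have "\<dots> = card {Y. X - set (t # ts) \<subseteq> Y \<and> Y \<subseteq> X \<and> P Y}"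
    unfolding decomp using disj fin t by (subst card_Un_disjoint) auto
  finally show ?case .
qed

lemma finite_tuples: "finite (tuples n m)"
  by (metis List.finite_set set_product_lists_upt)

lemma upds_less: "(\<And>i. v i < n) \<Longrightarrow> set t \<subseteq> {..<n} \<Longrightarrow> length t = length is \<Longrightarrow> upds v is t i < n"
proof (induction "is" arbitrary: v t)
  case (Cons j "is")
  then show ?case by (cases t) auto
qed simp

lemma length_sem_count_models:
  assumes A: "A \<in> structures \<sigma>" and n: "n = univ_size A" and wf: "formula_wf \<sigma> m \<psi>"
    and mono: "\<And>X Y. sat A X (\<lambda>_. 0) \<psi> \<Longrightarrow> X \<subseteq> Y \<Longrightarrow> sat A Y (\<lambda>_. 0) \<psi>"
    and D: "D 0 = (int n + 1, snd (input_tape (encode \<sigma> A)))" "D 1 = (0, \<lambda>_. 0)" "D 2 = (0, \<lambda>_. 0)"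
  shows "length (sem n (count_models \<sigma> m \<psi>) (\<lambda>_. 0) D) = Suc (count_SO m \<psi> A)"
proof -
  let ?T = "complement_tape n m"
  let ?P = "\<lambda>X. sat A X (\<lambda>_. 0) \<psi>"
  let ?c = "eval_formula \<sigma> (\<lambda>_. 0) (Suc m) \<psi>"
  let ?X = "tuples n m"
  have n0: "0 < n" using A n by (auto simp: structures_def)
  have D2: "D 2 = bit_tape False" using D(3) by (simp add: bit_tape_def)
  have "all_tuples n m ! k \<in> ?X" if "k < n ^ m" for k
    using that by (metis length_all_tuples nth_mem set_product_lists_upt)
  then have "?T ?X = (0, \<lambda>_. 0)" by (auto simp: complement_tape_def fun_eq_iff)
  then have D1: "D(1 := ?T ?X) = D" using D(2) by (simp add: fun_upd_idem)
  have c: "sem n ?c v (D(1 := ?T X)) = [D(1 := ?T X, 2 := bit_tape (?P X))]"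
    if "v 0 = 0" "\<And>i. v i < n" for v X
  proof -
    have v: "v \<circ> (\<lambda>_. 0) = (\<lambda>_. 0)" using that(1) by (simp add: comp_def)
    have "sem n ?c v (D(1 := ?T X)) =
        [(D(1 := ?T X))(2 := bit_tape (sat A X (v \<circ> (\<lambda>_. 0)) \<psi>))]"
      by (rule sem_eval_formula[OF A n wf]) (use that(2) D(1) D2 in simp_all)
    then show ?thesis unfolding v .
  qed
  have check: "sem n ?c (\<lambda>_. 0) D = [D(2 := bit_tape (?P ?X))]"
    using c[of "\<lambda>_. 0" ?X] n0 unfolding D1 by simp
  have D2': "D(2 := bit_tape False) = D" using D2 by (simp add: fun_upd_idem)
  show ?thesis
  proof (cases "?P ?X")
    case False
    \<comment> \<open>By monotonicity there is no model at all if the full relation is none; then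
      the initial test is the only execution.\<close>
    then have "{X. X \<subseteq> ?X \<and> ?P X} = {}" using mono by blast
    then have "count_SO m \<psi> A = 0" by (simp only: count_SO_def n card.empty)
    then show ?thesis using check False by (simp add: count_models_def Let_def reads_def)
  next
    case True
    define L where "L = all_tuples n m"
    let ?f = "\<lambda>t. sem n (choose_tuple m ?c) (upds (\<lambda>_. 0) [1..<Suc m] t)"
    have L: "set L = ?X" "distinct L"
      by (simp_all add: L_def set_product_lists_upt distinct_all_tuples)
    have f: "?f t (D(1 := ?T Y)) =
        (if ?P (Y - {t}) then [D(1 := ?T (Y - {t})), D(1 := ?T Y)] else [D(1 := ?T Y)])"
      if t: "t \<in> set L" "t \<in> Y" for t Y
    proof (rule sem_choose_tuple)
      have len: "length t = length [1..<Suc m]" "set t \<subseteq> {..<n}"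
        using t(1) L(1) by (auto simp: tuples_def)
      show "t \<in> set (all_tuples n m)" "t \<in> Y" using t by (simp_all add: L_def)
      show "map (upds (\<lambda>_. 0) [1..<Suc m] t) [1..<Suc m] = t"
        by (rule map_upds) (use len in auto)
      show "sem n ?c (upds (\<lambda>_. 0) [1..<Suc m] t) (D(1 := ?T (Y - {t}))) =
          [D(1 := ?T (Y - {t}), 2 := bit_tape (?P (Y - {t})))]"
      proof (rule c)
        show "upds (\<lambda>_. 0) [1..<Suc m] t 0 = 0" by (subst upds_notin) auto
        show "upds (\<lambda>_. 0) [1..<Suc m] t i < n" for i
          by (rule upds_less) (use n0 len in auto)
      qed
    qed (rule D2)
    have "length (iter ?f L (D(1 := ?T ?X))) = card {Y. ?X - set L \<subseteq> Y \<and> Y \<subseteq> ?X \<and> ?P Y}"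
      by (rule card_choices[where S = "\<lambda>X. D(1 := ?T X)"])
        (use True mono L finite_tuples f in auto)
    also have "\<dots> = count_SO m \<psi> A" by (simp add: L count_SO_def n)
    finally have "length (sem n (PFors [1..<Suc m] (choose_tuple m ?c)) (\<lambda>_. 0) D) = count_SO m \<psi> A"
      unfolding D1 by (simp add: sem_PFors L_def del: upt_Suc)
    then show ?thesis
      using check True
      by (simp add: count_models_def Let_def reads_def bit_tape_write D2 D2' sem_set_flag del: upt_Suc)
  qed
qed

lemma loop_vars_choose_tuple: "loop_vars c \<subseteq> {Suc m..} \<Longrightarrow> loop_vars (choose_tuple m c) \<subseteq> {Suc m..}"
  by (auto simp: choose_tuple_def loop_vars_access skip_def set_flag_def)

lemma prog_wf_count_models: "prog_wf (check_input \<sigma> (count_models \<sigma> m \<psi>))"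
proof -
  have "loop_vars (choose_tuple m (eval_formula \<sigma> (\<lambda>_. 0) (Suc m) \<psi>)) \<subseteq> {Suc m..}"
    by (rule loop_vars_choose_tuple) (rule loop_vars_eval_formula)
  then have "set [1..<Suc m] \<inter> loop_vars (choose_tuple m (eval_formula \<sigma> (\<lambda>_. 0) (Suc m) \<psi>)) = {}"
    by auto
  moreover have "prog_wf (choose_tuple m (eval_formula \<sigma> (\<lambda>_. 0) (Suc m) \<psi>))"
    by (simp add: choose_tuple_def prog_wf_access prog_wf_eval_formula skip_def set_flag_def)
  ultimately show ?thesis
    by (simp add: check_input_def count_models_def Let_def prog_wf_shift prog_wf_eval_formula
        skip_def set_flag_def del: upt_Suc)
qed

subsection \<open>The sentence\<close>

lemma formula_wf_first_order: "first_order \<sigma> \<phi> \<Longrightarrow> formula_wf \<sigma> m \<phi>"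
  by (induction \<phi>) auto

lemma formula_wf_sentence:
  "first_order \<sigma> \<phi> \<Longrightarrow> formula_wf \<sigma> (length zs) (Pi2_1VAR_sentence ys zs \<phi>)"
proof -
  assume "first_order \<sigma> \<phi>"
  then have "formula_wf \<sigma> (length zs) (Conj \<phi> (SOVar zs))" by (simp add: formula_wf_first_order)
  then have "formula_wf \<sigma> (length zs) (foldr Exists us (Conj \<phi> (SOVar zs)))" for us
    by (induction us) auto
  then show ?thesis
    unfolding Pi2_1VAR_sentence_def by (induction ys) (auto simp: Forall_def)
qed

lemma sat_first_order: "first_order \<sigma> \<phi> \<Longrightarrow> sat A X e \<phi> = sat A Y e \<phi>"
  by (induction \<phi> arbitrary: e) auto

text \<open>\<open>X\<close> occurs only in the matrix, below no negations but the pairs introduced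
  by \<open>Forall\<close>. Hence the induction runs along the two quantifier prefixes, not along
  arbitrary formulas.\<close>

lemma sat_sentence_mono:
  assumes "first_order \<sigma> \<phi>" "X \<subseteq> Y" "sat A X e (Pi2_1VAR_sentence ys zs \<phi>)"
  shows "sat A Y e (Pi2_1VAR_sentence ys zs \<phi>)"
proof -
  have "sat A X e (Conj \<phi> (SOVar zs)) \<Longrightarrow> sat A Y e (Conj \<phi> (SOVar zs))" for e
    using assms(2) sat_first_order[OF assms(1), of A X e Y] by auto
  then have "sat A X e (foldr Exists us (Conj \<phi> (SOVar zs))) \<Longrightarrow>
      sat A Y e (foldr Exists us (Conj \<phi> (SOVar zs)))" for e us
    by (induction us arbitrary: e) auto
  then have "sat A X e (foldr Forall ys (foldr Exists zs (Conj \<phi> (SOVar zs)))) \<Longrightarrow>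
      sat A Y e (foldr Forall ys (foldr Exists zs (Conj \<phi> (SOVar zs))))" for e
    by (induction ys arbitrary: e) (auto simp: Forall_def)
  then show ?thesis using assms(3) by (simp add: Pi2_1VAR_sentence_def)
qed

subsection \<open>Strings that encode structures\<close>

definition leading_zeros :: "bool list \<Rightarrow> nat" where
  "leading_zeros x = length (takeWhile Not x)"

lemma leading_zeros_encode: "leading_zeros (encode \<sigma> A) = univ_size A"
  by (simp add: leading_zeros_def encode_def takeWhile_append)

lemma length_encode:
  assumes "A \<in> structures \<sigma>"
  shows "is_code_length \<sigma> (univ_size A) (length (encode \<sigma> A))"
proof -
  have "map length (map2 (\<lambda>r R. map (\<lambda>v. v \<in> R) (all_tuples (univ_size A) r)) \<sigma> (rels A)) =
      map (\<lambda>r. univ_size A ^ r) \<sigma>"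
    using assms by (auto simp: list_eq_iff_nth_eq length_all_tuples structures_def)
  then show ?thesis by (simp add: is_code_length_def encode_def length_concat)
qed

lemma ex_rels:
  "length w = (\<Sum>r\<leftarrow>\<sigma>. n ^ r) \<Longrightarrow> \<exists>Rs. length Rs = length \<sigma> \<and>
    (\<forall>i < length \<sigma>. Rs ! i \<subseteq> tuples n (\<sigma> ! i)) \<and>
    concat (map2 (\<lambda>r R. map (\<lambda>v. v \<in> R) (all_tuples n r)) \<sigma> Rs) = w"
proof (induction \<sigma> arbitrary: w)
  case (Cons r \<sigma>)
  define L where "L = all_tuples n r"
  have L: "length L = n ^ r" "distinct L" "set L = tuples n r"
    by (simp_all add: L_def length_all_tuples distinct_all_tuples set_product_lists_upt)
  define R where "R = {L ! i | i. i < n ^ r \<and> w ! i}"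
  have R: "R \<subseteq> tuples n r" unfolding R_def L(3)[symmetric] L(1)[symmetric] by auto
  have "L ! i \<in> R \<longleftrightarrow> w ! i" if "i < n ^ r" for i
    using that L(1,2) by (auto simp: R_def nth_eq_iff_index_eq)
  then have take: "map (\<lambda>v. v \<in> R) L = take (n ^ r) w"
    using L(1) Cons.prems by (auto simp: list_eq_iff_nth_eq)
  obtain Rs where Rs: "length Rs = length \<sigma>" "\<forall>i < length \<sigma>. Rs ! i \<subseteq> tuples n (\<sigma> ! i)"
    "concat (map2 (\<lambda>r R. map (\<lambda>v. v \<in> R) (all_tuples n r)) \<sigma> Rs) = drop (n ^ r) w"
    using Cons.IH[of "drop (n ^ r) w"] Cons.prems by auto
  have "\<forall>i < length (r # \<sigma>). (R # Rs) ! i \<subseteq> tuples n ((r # \<sigma>) ! i)"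
    using R Rs(2) by (auto simp: nth_Cons split: nat.splits)
  then show ?case
    using Rs(1,3) take by (intro exI[of _ "R # Rs"]) (simp add: L_def)
qed simp

text \<open>By \<open>ex_rels\<close> every bit string of the right length is a list of tables, so
  the length is all that has to be tested behind the leading zeros. The first conjunct reflects that
  universes are nonempty.\<close>

lemma encodes_iff:
  "x \<in> encode \<sigma> ` structures \<sigma> \<longleftrightarrow>
    1 \<le> leading_zeros x \<and> is_code_length \<sigma> (leading_zeros x) (length x)"
proof (intro iffI)
  assume "x \<in> encode \<sigma> ` structures \<sigma>"
  then show "1 \<le> leading_zeros x \<and> is_code_length \<sigma> (leading_zeros x) (length x)"
    using length_encode by (auto simp: leading_zeros_encode structures_def)
next
  let ?n = "leading_zeros x"
  assume *: "1 \<le> ?n \<and> is_code_length \<sigma> ?n (length x)"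
  have tw: "takeWhile Not x = replicate ?n False"
    unfolding leading_zeros_def
    by (rule replicate_length_same[symmetric]) (auto dest: set_takeWhileD)
  have "?n < length x" using * by (simp add: is_code_length_def)
  then have "dropWhile Not x \<noteq> []"
    by (metis append_Nil2 leading_zeros_def less_irrefl takeWhile_dropWhile_id)
  then obtain w where dw: "dropWhile Not x = True # w"
    by (metis (full_types) hd_dropWhile list.exhaust_sel)
  have x: "x = replicate ?n False @ [True] @ w"
    using takeWhile_dropWhile_id[of Not x] tw dw by simp
  have "length x = ?n + 1 + length w" using arg_cong[OF x, of length] by simp
  then have "length w = (\<Sum>r\<leftarrow>\<sigma>. ?n ^ r)" using * by (simp add: is_code_length_def)
  from ex_rels[OF this] obtain Rs where Rs: "length Rs = length \<sigma>"
    "\<forall>i < length \<sigma>. Rs ! i \<subseteq> tuples ?n (\<sigma> ! i)"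
    "concat (map2 (\<lambda>r R. map (\<lambda>v. v \<in> R) (all_tuples ?n r)) \<sigma> Rs) = w"
    by blast
  let ?A = "\<lparr>univ_size = ?n, rels = Rs\<rparr>"
  have "?A \<in> structures \<sigma>" using * Rs by (simp add: structures_def)
  moreover have "encode \<sigma> ?A = x" using x Rs(3) by (simp add: encode_def)
  ultimately show "x \<in> encode \<sigma> ` structures \<sigma>" by (metis image_eqI)
qed

section \<open>The machine\<close>

text \<open>Distinct indices and an injective \<open>x\<close> guarantee that each tape still has
  its old contents when its turn comes.\<close>

lemma exec_foldr:
  assumes "distinct is" "inj x"
    and c: "\<And>i s. i \<in> set is \<Longrightarrow> s (x i) = old \<Longrightarrow> exec (c i) s T [s(x i := new)]"
    and old: "\<And>i. i \<in> set is \<Longrightarrow> s (x i) = old"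
    and c0: "exec c0 (\<lambda>k. if k \<in> x ` set is then new else s k) T0 ss"
  shows "exec (foldr (\<lambda>i. CSeq (c i)) is c0) s (length is * Suc T + T0) ss"
  using assms(1) c old c0
proof (induction "is" arbitrary: s)
  case (Cons i "is")
  have step: "exec (c i) s T [s(x i := new)]"
    by (rule Cons.prems(2)) (simp_all add: Cons.prems(3))
  have rest: "exec (foldr (\<lambda>i. CSeq (c i)) is c0) (s(x i := new)) (length is * Suc T + T0) ss"
  proof (rule Cons.IH)
    show "(s(x i := new)) (x i') = old" if "i' \<in> set is" for i'
    proof -
      have "x i' \<noteq> x i" using that Cons.prems(1) assms(2) by (auto dest: injD)
      then show ?thesis using Cons.prems(3)[of i'] that by simp
    qed
    have "(\<lambda>k. if k \<in> x ` set is then new else (s(x i := new)) k) =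
        (\<lambda>k. if k \<in> x ` set (i # is) then new else s k)"
      by auto
    then show "exec c0 (\<lambda>k. if k \<in> x ` set is then new else (s(x i := new)) k) T0 ss"
      using Cons.prems(4) by (simp only:)
    show "exec (c i') s' T [s'(x i' := new)]" if "i' \<in> set is" "s' (x i') = old" for i' s'
      by (rule Cons.prems(2)) (use that in auto)
  qed (use Cons.prems(1) in simp)
  have "exec (foldr (\<lambda>i. CSeq (c i)) (i # is) c0) s (Suc (T + (length is * Suc T + T0))) ss"
    using exec_Seq1[OF step rest] by simp
  then show ?case by (simp add: add_ac)
qed simp

definition mark_step :: "nat \<Rightarrow> cmd" where
  "mark_step V = foldr (\<lambda>i. CSeq (CSeq (CWrite (2 * i + 3) [1]) (CMove (2 * i + 3) Rgt))) [0..<V]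
     (CMove 0 Rgt)"

text \<open>Marks as many cells on the tapes of the variables below \<open>V\<close> as the input has leading
  zeros.\<close>

definition init_vars :: "nat \<Rightarrow> cmd" where
  "init_vars V = CSeq (CWrite 1 [2]) (CSeq (CWhile [(0, 1)] (mark_step V))
     (foldr (\<lambda>i. CSeq (rewind (2 * i + 3))) [0..<V] (CMove 0 Stay)))"

text \<open>Variables need values below \<open>n\<close>, so \<open>compile p\<close> runs only for
  positive \<open>n\<close>; an input without a leading zero gets a single path.\<close>

definition run_prog :: "nat \<Rightarrow> prog \<Rightarrow> cmd" where
  "run_prog V p = CIf [(0, 1)] (CSeq (init_vars V) (compile p)) (CMove 0 Stay)"

definition input_data :: "nat \<Rightarrow> bool list \<Rightarrow> store" where
  "input_data n x = (\<lambda>_. (0, \<lambda>_. 0))(0 := (int n, snd (input_tape x)))"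

text \<open>The tapes of the variables from \<open>V\<close> on do not exist in the machine. They are taken to be
  initialized from the start.\<close>

definition init_store :: "nat \<Rightarrow> nat \<Rightarrow> bool list \<Rightarrow> nat \<Rightarrow> store" where
  "init_store V n x a k = (if k \<in> (\<lambda>i. 2 * i + 3) ` {0..<V} then (int a, marks a)
     else if k = 0 then (int a, snd (input_tape x)) else layout n (\<lambda>_. 0) (\<lambda>_. (0, \<lambda>_. 0)) k)"

lemma inj_var_tape: "inj (\<lambda>i :: nat. 2 * i + 3)"
  by (auto simp: inj_def)

text \<open>Symbol 1 is a false bit; behind the leading zeros comes a true bit or the end of the
  input.\<close>

lemma reads_leading_zeros:
  assumes "n = leading_zeros x"
  shows "a < n \<Longrightarrow> read_tape (int a, snd (input_tape x)) = 1"
    and "read_tape (int n, snd (input_tape x)) \<noteq> 1"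
proof -
  have "\<not> x ! a" "a < length x" if "a < n"
  proof -
    have "takeWhile Not x ! a \<in> set (takeWhile Not x)"
      using that by (simp add: assms leading_zeros_def)
    then show "\<not> x ! a"
      using that by (metis assms leading_zeros_def set_takeWhileD takeWhile_nth)
    show "a < length x"
      using that length_takeWhile_le[of Not x] by (simp add: assms leading_zeros_def)
  qed
  then show "a < n \<Longrightarrow> read_tape (int a, snd (input_tape x)) = 1"
    by (simp add: read_input_tape symbol_of_bit_def)
  have "x ! n" if "n < length x"
    using that nth_length_takeWhile[of Not x] by (simp add: assms leading_zeros_def)
  then show "read_tape (int n, snd (input_tape x)) \<noteq> 1"
    by (simp add: read_input_tape symbol_of_bit_def blank_def)
qed

lemma exec_mark_step:
  "exec (mark_step V) (init_store V n x a) (V * 4 + 1) [init_store V n x (Suc a)]"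
proof -
  let ?s = "init_store V n x a"
  let ?old = "(int a, marks a)" and ?new = "(int (Suc a), marks (Suc a))"
  have step: "exec (CSeq (CWrite y [1]) (CMove y Rgt)) s (Suc (1 + 1)) [s(y := ?new)]"
    if "s y = ?old" for y s
  proof (rule exec_Seq1)
    show "exec (CWrite y [1]) s 1 [s(y := (int a, marks (Suc a)))]"
    proof -
      have "(marks a)(int a := 1) = marks (Suc a)" by (auto simp: marks_def fun_eq_iff)
      then show ?thesis using exec_Write[of y "[1]" s] that by simp
    qed
    show "exec (CMove y Rgt) (s(y := (int a, marks (Suc a)))) 1 [s(y := ?new)]"
      by (rule exec_Move_to) (simp add: add.commute)
  qed
  have "exec (mark_step V) ?s (length [0..<V] * Suc (Suc (1 + 1)) + 1) [init_store V n x (Suc a)]"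
    unfolding mark_step_def
  proof (rule exec_foldr[where x = "\<lambda>i. 2 * i + 3" and old = ?old and new = ?new])
    show "exec (CMove 0 Rgt) (\<lambda>k. if k \<in> (\<lambda>i. 2 * i + 3) ` set [0..<V] then ?new else ?s k) 1
        [init_store V n x (Suc a)]"
      by (rule exec_Move_to) (auto simp: init_store_def fun_eq_iff)
  qed (use inj_var_tape step in \<open>auto simp: init_store_def\<close>)
  then show ?thesis by (rule exec_mono) simp
qed

text \<open>Tape 1 starts blank because its mark is written here. The variable heads are rewound,
  but the input head stays behind the leading zeros, where \<open>check_input\<close>
  starts.\<close>

lemma exec_init_vars:
  assumes n: "n = leading_zeros x"
  shows "exec (init_vars V) ((init_store V n x 0)(1 := (0, \<lambda>_. 0)))
    (n * (4 * V + 2) + V * (2 * n + 6) + 6) [layout n (\<lambda>_. 0) (input_data n x)]"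
proof -
  let ?S = "init_store V n x"
  have one: "1 \<notin> (\<lambda>i. 2 * i + 3) ` {0..<V}" by auto
  then have S1: "?S a 1 = (0, zero_mark)" for a by (simp add: init_store_def)
  have zero: "0 \<notin> (\<lambda>i. 2 * i + 3) ` {0..<V}" by auto
  then have S0: "?S a 0 = (int a, snd (input_tape x))" for a by (simp add: init_store_def)
  have "(\<lambda>_. 0)(0 := 2) = zero_mark" by (auto simp: zero_mark_def fun_eq_iff)
  moreover have "(?S 0)(1 := (0, zero_mark)) = ?S 0" using S1 by (simp add: fun_upd_idem)
  ultimately have 1: "exec (CWrite 1 [2]) ((?S 0)(1 := (0, \<lambda>_. 0))) 1 [?S 0]"
    using exec_Write[of 1 "[2]" "(?S 0)(1 := (0, \<lambda>_. 0))"] by simp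
  have 2: "exec (CWhile [(0, 1)] (mark_step V)) (?S 0) (Suc (n * Suc (V * 4 + 1))) [?S n]"
    by (rule exec_While_loop[where S = ?S])
      (simp_all add: exec_mark_step[simplified] holds_def reads_def S0 reads_leading_zeros[OF n, simplified])
  have 3: "exec (foldr (\<lambda>i. CSeq (rewind (2 * i + 3))) [0..<V] (CMove 0 Stay)) (?S n)
      (length [0..<V] * Suc (2 * n + 5) + 1) [layout n (\<lambda>_. 0) (input_data n x)]"
  proof (rule exec_foldr[where x = "\<lambda>i. 2 * i + 3" and old = "(int n, marks n)" and new = "(0, marks n)"])
    show "exec (CMove 0 Stay) (\<lambda>k. if k \<in> (\<lambda>i. 2 * i + 3) ` set [0..<V] then (0, marks n) else ?S n k) 1
        [layout n (\<lambda>_. 0) (input_data n x)]"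
    proof (rule exec_Move_to)
      show "layout n (\<lambda>_. 0) (input_data n x) =
        (\<lambda>k. if k \<in> (\<lambda>i. 2 * i + 3) ` set [0..<V] then (0, marks n) else ?S n k)
        (0 := (fst (if 0 \<in> (\<lambda>i. 2 * i + 3) ` set [0..<V] then (0, marks n) else ?S n 0) + offset Stay,
          snd (if 0 \<in> (\<lambda>i. 2 * i + 3) ` set [0..<V] then (0, marks n) else ?S n 0)))"
        by (rule ext) (auto simp: init_store_def layout_def input_data_def)
    qed
  qed (use inj_var_tape exec_rewind in \<open>auto simp: init_store_def\<close>)
  have "exec (init_vars V) ((?S 0)(1 := (0, \<lambda>_. 0)))
    (Suc (1 + Suc (Suc (n * Suc (V * 4 + 1)) + (length [0..<V] * Suc (2 * n + 5) + 1))))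
    [layout n (\<lambda>_. 0) (input_data n x)]"
    unfolding init_vars_def by (rule exec_Seq1[OF 1 exec_Seq1[OF 2 3]])
  then show ?thesis by (rule exec_mono) (simp add: algebra_simps)
qed

lemma exec_run_prog:
  assumes n: "n = leading_zeros x" and p: "prog_wf p"
  shows "\<exists>ss. exec (run_prog V p) ((init_store V n x 0)(1 := (0, \<lambda>_. 0)))
      (n * (4 * V + 2) + V * (2 * n + 6) + time n p + 8) ss \<and>
    length ss = (if n = 0 then 1 else length (sem n p (\<lambda>_. 0) (input_data n x)))"
    (is "\<exists>ss. exec _ _ ?T ss \<and> length ss = ?N")
proof -
  let ?s = "(init_store V n x 0)(1 := (0, \<lambda>_. 0))"
  have "0 \<notin> (\<lambda>i. 2 * i + 3) ` {0..<V}" by auto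
  then have s0: "?s 0 = (int 0, snd (input_tape x))" by (simp add: init_store_def)
  have "reads ?s 0 = read_tape (int 0, snd (input_tape x))" by (simp only: reads_def s0)
  then have holds: "holds [(0, 1)] (reads ?s) \<longleftrightarrow> n \<noteq> 0"
    using reads_leading_zeros(1)[OF n, of 0] reads_leading_zeros(2)[OF n]
    by (cases "n = 0") (simp_all add: holds_def)
  show ?thesis
  proof (cases "n = 0")
    case True
    have "exec (run_prog V p) ?s (Suc 1) [?s(0 := (fst (?s 0) + offset Stay, snd (?s 0)))]"
      unfolding run_prog_def
    proof (rule exec_If)
      have "\<not> holds [(0, 1)] (reads ?s)" using True holds by simp
      then show "exec (if holds [(0, 1)] (reads ?s) then CSeq (init_vars V) (compile p)
          else CMove 0 Stay) ?s 1 [?s(0 := (fst (?s 0) + offset Stay, snd (?s 0)))]"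
        by (simp only: if_False exec_Move)
    qed
    then have "exec (run_prog V p) ?s ?T [?s(0 := (fst (?s 0) + offset Stay, snd (?s 0)))]"
      by (rule exec_mono) simp
    moreover have "length [?s(0 := (fst (?s 0) + offset Stay, snd (?s 0)))] = ?N"
      using True by simp
    ultimately show ?thesis by blast
  next
    case False
    have "exec (compile p) (layout n (\<lambda>_. 0) (input_data n x)) (time n p)
        (map (layout n (\<lambda>_. 0)) (sem n p (\<lambda>_. 0) (input_data n x)))"
      by (rule exec_compile) (use False p in auto)
    from exec_Seq1[OF exec_init_vars[OF n, of V] this]
    have "exec (run_prog V p) ?s (Suc (Suc (n * (4 * V + 2) + V * (2 * n + 6) + 6 + time n p)))
        (map (layout n (\<lambda>_. 0)) (sem n p (\<lambda>_. 0) (input_data n x)))"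
      unfolding run_prog_def using False holds by (intro exec_If) simp
    then have "exec (run_prog V p) ?s ?T
        (map (layout n (\<lambda>_. 0)) (sem n p (\<lambda>_. 0) (input_data n x)))"
      by (rule exec_mono) simp
    moreover have "length (map (layout n (\<lambda>_. 0)) (sem n p (\<lambda>_. 0) (input_data n x))) = ?N"
      using False by simp
    ultimately show ?thesis by blast
  qed
qed

lemma cmd_wf_foldr:
  "(\<And>i. i \<in> set is \<Longrightarrow> cmd_wf k (c i)) \<Longrightarrow> cmd_wf k c0 \<Longrightarrow> cmd_wf k (foldr (\<lambda>i. CSeq (c i)) is c0)"
  by (induction "is") auto

text \<open>\<open>V\<close> bounds all tapes of \<open>compile p\<close>, hence also its variables;
  the tapes of the variables below \<open>V\<close> end at \<open>2 * V + 1\<close>.\<close>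

lemma cmd_wf_run_prog:
  "cmd_wf V (compile p) \<Longrightarrow> cmd_wf (2 * V + 3) (run_prog V p)"
  by (auto simp: run_prog_def init_vars_def mark_step_def rewind_def
      intro!: cmd_wf_foldr intro: cmd_wf_mono)

text \<open>\<open>marks 0\<close> is blank, so the early initialization of variables shows only on
  tapes that the machine does not have.\<close>

lemma tapes_of_init_store:
  "tapes_of (2 * V + 3) ((init_store V n x 0)(1 := (0, \<lambda>_. 0))) =
    input_tape x # replicate (2 * V + 2) (0, \<lambda>_. blank)"
proof (rule nth_equalityI)
  fix k
  assume "k < length (tapes_of (2 * V + 3) ((init_store V n x 0)(1 := (0, \<lambda>_. 0))))"
  then have k: "k < 2 * V + 3" by simp
  have m: "marks 0 = (\<lambda>_. 0)" by (auto simp: marks_def fun_eq_iff)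
  consider "k = 0" | "k = 1" | "k \<in> (\<lambda>i. 2 * i + 3) ` {0..<V}" | j where "k = 2 * j" "0 < j"
  proof (cases "even k")
    case True
    then show ?thesis using that by (cases "k = 0") auto
  next
    case False
    then obtain j where j: "k = 2 * j + 1" by (auto elim: oddE)
    show ?thesis
    proof (cases j)
      case 0
      then show ?thesis using that j by simp
    next
      case (Suc i)
      then have "k = 2 * i + 3" "i < V" using j k by auto
      then show ?thesis using that by auto
    qed
  qed
  then show "tapes_of (2 * V + 3) ((init_store V n x 0)(1 := (0, \<lambda>_. 0))) ! k =
      (input_tape x # replicate (2 * V + 2) (0, \<lambda>_. blank)) ! k"
  proof cases
    case 1
    moreover have "0 \<notin> (\<lambda>i. 2 * i + 3) ` {0..<V}" by auto
    ultimately show ?thesis by (simp add: tapes_of_def init_store_def input_tape_def)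
  next
    case 4
    then have "k \<notin> (\<lambda>i. 2 * i + 3) ` {0..<V}" by (auto, presburger)
    then show ?thesis using k 4
      by (simp add: tapes_of_def init_store_def layout_def nth_Cons' blank_def)
  qed (use k in \<open>auto simp: tapes_of_def init_store_def nth_Cons' blank_def m\<close>)
qed simp

lemma store_wf_init_store:
  "store_wf (2 * V + 3) ((init_store V n x 0)(1 := (0, \<lambda>_. 0)))"
proof -
  let ?s = "(init_store V n x 0)(1 := (0, \<lambda>_. 0))"
  have "snd (?s k) z \<le> 2" if "k < 2 * V + 3" for k z
  proof -
    have "?s k = tapes_of (2 * V + 3) ?s ! k" using that by (simp add: tapes_of_def)
    also have "\<dots> \<in> {input_tape x, (0, \<lambda>_. blank)}"
      unfolding tapes_of_init_store using that by (auto simp: nth_Cons')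
    finally show ?thesis by (auto simp: input_tape_def symbol_of_bit_def blank_def)
  qed
  then show ?thesis by (simp add: store_wf_def)
qed

section \<open>From programs to \<open>TotP\<close>\<close>

lemma TotP_if_prog:
  assumes p: "prog_wf p"
  shows "(\<lambda>x. if leading_zeros x = 0 then 0
    else length (sem (leading_zeros x) p (\<lambda>_. 0) (input_data (leading_zeros x) x)) - 1) \<in> TotP"
proof -
  obtain V where V: "cmd_wf V (compile p)" using ex_cmd_wf_compile[OF p] by blast
  define M where "M = machine (2 * V + 3) (run_prog V p)"
  have wf: "cmd_wf (2 * V + 3) (run_prog V p)" using cmd_wf_run_prog[OF V] .
  let ?n = leading_zeros
  define T where "T n = n * (4 * V + 2) + V * (2 * n + 6) + time n p + 8" for n
  define N where "N x = (if ?n x = 0 then 1 else length (sem (?n x) p (\<lambda>_. 0) (input_data (?n x) x)))" for x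
  have M: "(\<forall>ts c. run M (init_config M x) ts c \<longrightarrow> length ts \<le> T (?n x)) \<and>
      card (computation_paths M x) = N x" for x
  proof -
    let ?s = "(init_store V (?n x) x 0)(1 := (0, \<lambda>_. 0))"
    obtain ss where ss: "exec (run_prog V p) ?s (T (?n x)) ss" "length ss = N x"
      using exec_run_prog[OF refl p, of V x] unfolding T_def N_def by blast
    have conf: "init_config M x = (to_nat [run_prog V p], tapes_of (2 * V + 3) ?s)"
      by (simp only: init_config_def M_def machine_def ntm.select_convs tapes_of_init_store) simp
    have paths: "computation_paths M x = halting_paths M (to_nat [run_prog V p], tapes_of (2 * V + 3) ?s)"
      by (simp only: computation_paths_def halting_paths_def conf)
    have "[run_prog V p] \<in> insert [] (stacks (run_prog V p) [])"
      using Cons_in_stacks by blast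
    from tree_halting_paths[OF exec_tree[OF ss(1)] wf _ store_wf_init_store this]
    show ?thesis
      unfolding paths conf ss(2) M_def[symmetric] by simp
  qed
  obtain P :: "nat poly" where P: "\<forall>n. time n p \<le> poly P n" using time_poly by blast
  have "poly_time M"
    unfolding poly_time_def
  proof (intro exI allI impI)
    fix x ts c
    \<comment> \<open>The terms of \<open>T\<close> other than \<open>time\<close> add up to
      \<open>n * (6 * V + 2) + (6 * V + 8)\<close>.\<close>
    let ?Q = "[:6 * V + 8, 6 * V + 2:] + P"
    assume "run M (init_config M x) ts c"
    then have "length ts \<le> T (?n x)" using M by blast
    also have "T (?n x) \<le> poly ?Q (?n x)"
      using P[rule_format, of "?n x"] by (simp add: T_def algebra_simps)
    also have "\<dots> \<le> poly ?Q (length x)"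
      by (rule poly_nat_mono) (simp add: leading_zeros_def length_takeWhile_le)
    finally show "length ts \<le> poly ?Q (length x)" .
  qed
  moreover have "wf_ntm M" unfolding M_def by (rule wf_machine[OF wf]) simp
  ultimately have "tot M \<in> TotP" unfolding TotP_def by blast
  moreover have "tot M x = N x - 1" for x using M[of x] by (simp only: tot_def)
  then have "tot M = (\<lambda>x. if ?n x = 0 then 0
      else length (sem (?n x) p (\<lambda>_. 0) (input_data (?n x) x)) - 1)"
    by (auto simp: N_def fun_eq_iff)
  ultimately show ?thesis by (simp only:)
qed

theorem theorem6: "(\<Union>\<sigma>. on_strings \<sigma> ` sharp_Pi2_1VAR \<sigma>) \<subseteq> TotP"
proof (intro UN_least image_subsetI)
  fix \<sigma> B
  assume "B \<in> sharp_Pi2_1VAR \<sigma>"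
  then obtain ys zs \<phi> where \<phi>: "first_order \<sigma> \<phi>"
    and B: "\<forall>A \<in> structures \<sigma>. B A = count_SO (length zs) (Pi2_1VAR_sentence ys zs \<phi>) A"
    unfolding sharp_Pi2_1VAR_def by blast
  define m where "m = length zs"
  define \<psi> where "\<psi> = Pi2_1VAR_sentence ys zs \<phi>"
  define p where "p = check_input \<sigma> (count_models \<sigma> m \<psi>)"
  let ?n = leading_zeros
  have "on_strings \<sigma> B x = (if ?n x = 0 then 0
      else length (sem (?n x) p (\<lambda>_. 0) (input_data (?n x) x)) - 1)" for x
  proof (cases "x \<in> encode \<sigma> ` structures \<sigma>")
    case True
    then obtain A where A: "A \<in> structures \<sigma>" "x = encode \<sigma> A" by (elim imageE)
    have n: "?n x = univ_size A" by (simp add: A(2) leading_zeros_encode)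
    have code: "1 \<le> ?n x" "is_code_length \<sigma> (?n x) (length x)" using True unfolding encodes_iff by simp_all
    have D0: "input_data (?n x) x 0 = (int (?n x), snd (input_tape x))" by (simp add: input_data_def)
    have "x ! ?n x" "?n x < length x"
      unfolding n by (simp_all add: A(2) encode_def nth_append)
    with code(2) have "sem (?n x) p (\<lambda>_. 0) (input_data (?n x) x) =
        sem (?n x) (count_models \<sigma> m \<psi>) (\<lambda>_. 0)
          ((input_data (?n x) x)(0 := (int (?n x) + 1, snd (input_tape x))))"
      unfolding p_def by (intro sem_check_input(1)[where D = "input_data (?n x) x", OF D0] conjI)
    also have "length \<dots> = Suc (count_SO m \<psi> A)"
    proof (rule length_sem_count_models[OF A(1) n])
      show "formula_wf \<sigma> m \<psi>" unfolding m_def \<psi>_def by (rule formula_wf_sentence[OF \<phi>])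
      show "sat A Y (\<lambda>_. 0) \<psi>" if "sat A X (\<lambda>_. 0) \<psi>" "X \<subseteq> Y" for X Y
        using that unfolding \<psi>_def by (rule sat_sentence_mono[OF \<phi>, rotated])
    qed (simp_all add: A(2) input_data_def)
    also have "count_SO m \<psi> A = B A" using B A(1) unfolding m_def \<psi>_def by metis
    also have "B A = on_strings \<sigma> B x" unfolding A(2) by (rule on_strings_encode[OF A(1), symmetric])
    finally show ?thesis using code(1) by simp
  next
    \<comment> \<open>Outside the encodings the value is 0. Either there is no leading zero, or the
      test of the input fails and leaves one execution, from which 1 is subtracted.\<close>
    case False
    have D0: "input_data (?n x) x 0 = (int (?n x), snd (input_tape x))" by (simp add: input_data_def)
    show ?thesis
    proof (cases "?n x = 0")
      case True
      then show ?thesis using False by (simp only: on_strings_def if_False if_True if_cancel diff_self_eq_0 refl)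
    next
      case nonzero: False
      then have "\<not> is_code_length \<sigma> (?n x) (length x)" using False nonzero unfolding encodes_iff by simp
      then have "length (sem (?n x) p (\<lambda>_. 0) (input_data (?n x) x)) = 1"
        unfolding p_def
        by (intro sem_check_input(2)[where D = "input_data (?n x) x", OF D0] notI) (elim conjE notE)
      then show ?thesis using False by (simp only: on_strings_def if_False if_True if_cancel diff_self_eq_0 refl)
    qed
  qed
  then have "on_strings \<sigma> B = (\<lambda>x. if ?n x = 0 then 0
      else length (sem (?n x) p (\<lambda>_. 0) (input_data (?n x) x)) - 1)"
    by (rule ext)
  moreover have "prog_wf p" unfolding p_def by (rule prog_wf_count_models)
  ultimately show "on_strings \<sigma> B \<in> TotP" using TotP_if_prog by (simp only:)
qed

end
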